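(* Let $n\ge1$, let $\Omega\subset\mathbb{R}^n$ be a bounded open set with smooth boundary, let $s\in(0,1)$, and let $h$, $f$, $g$ satisfy the hypotheses (H)$_h$, (H)$_f$, (H)$_g$ described in the context. Assume moreover that $h$ is non-increasing and $g$ is non-decreasing. Then there exists at most one distributional solution $u$ (in the sense described in the context) of $$-\Delta u+(-\Delta)^s u+g(u)=h(u)f \text{ in }\Omega,\qquad u>0\text{ in }\Omega,\qquad u=0\text{ in }\mathbb{R}^n\setminus\Omega,$$ such that $u|_\Omega\in H_0^1(\Omega)$ and $g(u)\in L^1(\Omega)$.
   Context: (H)$_h$: $h:[0,+\infty)\to(0,+\infty]$ is continuous, possibly singular at $0$ (i.e. $h(0)=+\infty$ allowed), finite on $(0,+\infty)$, with $h(0)\neq0$; moreover (h1) there exist $\gamma\in[0,1]$, $\underline C,\underline s>0$ with $h(t)\le \underline C\,t^{-\gamma}$ for all $t\le\underline s$, and (h2) there exist $\theta\ge0$, $\overline C>0$, $\overline s>\underline s$ with $h(t)\le\overline C\,t^{-\theta}$ for all $t\ge\overline s$. (H)$_f$: $f:\Omega\to[0,+\infty)$ is measurable; if $1/2<s<1$ then $|\{x\in\Omega: f(x)=0\}|=0$; moreover either $\theta\ge1$ and $f\in L^1(\Omega)$, or $\theta<1$ and $f\in L^m(\Omega)$ for some $m>1$. (H)$_g$: $g:[0,+\infty)\to[0,+\infty)$ is continuous with $g(0)=0$; in the case $\theta<1$ one further assumes (g1): there exist $q\ge\frac{1-m\theta}{m-1}$ and $\nu,s_1>0$ with $g(t)\ge\nu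 t^q$ for all $t\ge s_1$. Distributional solution: a function $u\in W^{1,1}(\mathbb{R}^n)$ such that (i) $u|_\Omega\in W_0^{1,1}(\Omega)$ and $u=0$ a.e. in $\mathbb{R}^n\setminus\Omega$; (ii) $u>0$ in $\Omega$; (iii) $g(u),\,h(u)f\in L^1_{\mathrm{loc}}(\Omega)$; (iv) for every $\varphi\in C_0^\infty(\Omega)$, $$\int_\Omega\nabla u\cdot\nabla\varphi\,dx+\iint_{\mathbb{R}^{2n}}\frac{(u(x)-u(y))(\varphi(x)-\varphi(y))}{|x-y|^{n+2s}}\,dx\,dy+\int_\Omega g(u)\varphi\,dx=\int_\Omega h(u)f\varphi\,dx.$$ *)

theory Defs
  imports "HOL-Analysis.Analysis"
begin

fun dderiv :: "'a::euclidean_space list \<Rightarrow> ('a \<Rightarrow> real) \<Rightarrow> 'a \<Rightarrow> real" where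
  "dderiv [] f = f"
| "dderiv (v # vs) f = (\<lambda>x. frechet_derivative (dderiv vs f) (at x) v)"

definition smooth_on :: "'a::euclidean_space set \<Rightarrow> ('a \<Rightarrow> real) \<Rightarrow> bool" where
  "smooth_on U f \<longleftrightarrow>
     (\<forall>vs. (\<forall>x\<in>U. dderiv vs f differentiable (at x)) \<and> continuous_on U (dderiv vs f))"

definition grad :: "('a::euclidean_space \<Rightarrow> real) \<Rightarrow> 'a \<Rightarrow> 'a" where
  "grad f x = (\<Sum>i\<in>Basis. frechet_derivative f (at x) i *\<^sub>R i)"

definition smooth_boundary :: "'a::euclidean_space set \<Rightarrow> bool" where
  "smooth_boundary \<Omega> \<longleftrightarrow>
     (\<forall>x\<in>frontier \<Omega>. \<exists>U \<phi>. open U \<and> x \<in> U \<and> smooth_on U \<phi> \<and>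
        (\<forall>y\<in>U. grad \<phi> y \<noteq> 0) \<and> \<Omega> \<inter> U = {y\<in>U. \<phi> y < 0})"

definition test_fun :: "'a::euclidean_space set \<Rightarrow> ('a \<Rightarrow> real) \<Rightarrow> bool" where
  "test_fun U \<phi> \<longleftrightarrow> smooth_on UNIV \<phi> \<and> compact (closure {x. \<phi> x \<noteq> 0})
      \<and> closure {x. \<phi> x \<noteq> 0} \<subseteq> U"

definition loc_integrable :: "'a::euclidean_space set \<Rightarrow> ('a \<Rightarrow> real) \<Rightarrow> bool" where
  "loc_integrable U v \<longleftrightarrow> v \<in> borel_measurable (lebesgue_on U) \<and>
      (\<forall>K. compact K \<and> K \<subseteq> U \<longrightarrow> integrable (lebesgue_on K) v)"

definition weak_grad :: "'a::euclidean_space set \<Rightarrow> ('a \<Rightarrow> real) \<Rightarrow> ('a \<Rightarrow> 'a) \<Rightarrow> bool" where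
  "weak_grad U u G \<longleftrightarrow> loc_integrable U u \<and> (\<forall>i\<in>Basis. loc_integrable U (\<lambda>x. G x \<bullet> i)) \<and>
     (\<forall>\<phi> i. test_fun U \<phi> \<and> i \<in> Basis \<longrightarrow>
        (\<integral>x. u x * frechet_derivative \<phi> (at x) i \<partial>lebesgue_on U)
          = - (\<integral>x. (G x \<bullet> i) * \<phi> x \<partial>lebesgue_on U))"

definition sobolev_grad :: "real \<Rightarrow> 'a::euclidean_space set \<Rightarrow> ('a \<Rightarrow> real) \<Rightarrow> ('a \<Rightarrow> 'a) \<Rightarrow> bool" where
  "sobolev_grad p U u G \<longleftrightarrow> weak_grad U u G \<and>
     u \<in> borel_measurable (lebesgue_on U) \<and> integrable (lebesgue_on U) (\<lambda>x. \<bar>u x\<bar> powr p) \<and>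
     G \<in> borel_measurable (lebesgue_on U) \<and> integrable (lebesgue_on U) (\<lambda>x. norm (G x) powr p)"

definition sobolev :: "real \<Rightarrow> 'a::euclidean_space set \<Rightarrow> ('a \<Rightarrow> real) \<Rightarrow> bool" where
  "sobolev p U u \<longleftrightarrow> (\<exists>G. sobolev_grad p U u G)"

text \<open>W_0^{1,p}(U): closure of C_c^infinity(U) in the W^{1,p}(U) norm
  (u is considered through its restriction to U). H_0^1 = W_0^{1,2}.\<close>
definition sobolev0 :: "real \<Rightarrow> 'a::euclidean_space set \<Rightarrow> ('a \<Rightarrow> real) \<Rightarrow> bool" where
  "sobolev0 p U u \<longleftrightarrow> (\<exists>G. sobolev_grad p U u G \<and>
     (\<exists>\<phi>::nat \<Rightarrow> 'a \<Rightarrow> real. (\<forall>k. test_fun U (\<phi> k)) \<and>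
        (\<lambda>k. (\<integral>x. \<bar>\<phi> k x - u x\<bar> powr p \<partial>lebesgue_on U)
            + (\<integral>x. norm (grad (\<phi> k) x - G x) powr p \<partial>lebesgue_on U)) \<longlonglongrightarrow> 0))"

text \<open>(H)_h, (H)_f, (H)_g together (they share the parameters theta and m).
  h : [0,+inf) -> (0,+inf] is modelled as real => ereal.\<close>
definition hyp_hfg :: "real \<Rightarrow> 'a::euclidean_space set \<Rightarrow> (real \<Rightarrow> ereal) \<Rightarrow> ('a \<Rightarrow> real)
     \<Rightarrow> (real \<Rightarrow> real) \<Rightarrow> bool" where
  "hyp_hfg s \<Omega> h f g \<longleftrightarrow>
     continuous_on {0..} h \<and> (\<forall>t\<ge>0. 0 < h t) \<and> (\<forall>t>0. h t < \<infinity>) \<and> h 0 \<noteq> 0 \<and>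
     f \<in> borel_measurable (lebesgue_on \<Omega>) \<and> (\<forall>x\<in>\<Omega>. 0 \<le> f x) \<and>
     (1/2 < s \<and> s < 1 \<longrightarrow> emeasure lebesgue {x\<in>\<Omega>. f x = 0} = 0) \<and>
     continuous_on {0..} g \<and> g 0 = 0 \<and> (\<forall>t\<ge>0. 0 \<le> g t) \<and>
     (\<exists>\<gamma> C1 s1 \<theta> C2 s2.
        0 \<le> \<gamma> \<and> \<gamma> \<le> 1 \<and> 0 < C1 \<and> 0 < s1 \<and>
        (\<forall>t. 0 < t \<and> t \<le> s1 \<longrightarrow> h t \<le> ereal (C1 * t powr (-\<gamma>))) \<and>
        0 \<le> \<theta> \<and> 0 < C2 \<and> s1 < s2 \<and>
        (\<forall>t. s2 \<le> t \<longrightarrow> h t \<le> ereal (C2 * t powr (-\<theta>))) \<and>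
        ((1 \<le> \<theta> \<and> integrable (lebesgue_on \<Omega>) f) \<or>
         (\<theta> < 1 \<and> (\<exists>m>1. integrable (lebesgue_on \<Omega>) (\<lambda>x. \<bar>f x\<bar> powr m) \<and>
             (\<exists>q \<nu> s3. (1 - m * \<theta>) / (m - 1) \<le> q \<and> 0 < \<nu> \<and> 0 < s3 \<and>
                (\<forall>t. s3 \<le> t \<longrightarrow> \<nu> * t powr q \<le> g t))))))"

definition dist_solution :: "real \<Rightarrow> 'a::euclidean_space set \<Rightarrow> (real \<Rightarrow> ereal) \<Rightarrow> ('a \<Rightarrow> real)
     \<Rightarrow> (real \<Rightarrow> real) \<Rightarrow> ('a \<Rightarrow> real) \<Rightarrow> bool" where
  "dist_solution s \<Omega> h f g u \<longleftrightarrow>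
     (\<exists>G. sobolev_grad 1 UNIV u G \<and>
        sobolev0 1 \<Omega> u \<and>
        (AE x in lebesgue. x \<notin> \<Omega> \<longrightarrow> u x = 0) \<and>
        (AE x in lebesgue_on \<Omega>. 0 < u x) \<and>
        loc_integrable \<Omega> (\<lambda>x. g (u x)) \<and>
        loc_integrable \<Omega> (\<lambda>x. real_of_ereal (h (u x)) * f x) \<and>
        (\<forall>\<phi>. test_fun \<Omega> \<phi> \<longrightarrow>
           integrable (lebesgue \<Otimes>\<^sub>M lebesgue)
             (\<lambda>(x, y). (u x - u y) * (\<phi> x - \<phi> y) / norm (x - y) powr (real DIM('a) + 2 * s)) \<and>
           (\<integral>x. G x \<bullet> grad \<phi> x \<partial>lebesgue_on \<Omega>)
           + (\<integral>z. (case z of (x, y) \<Rightarrow>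
                (u x - u y) * (\<phi> x - \<phi> y) / norm (x - y) powr (real DIM('a) + 2 * s))
                \<partial>(lebesgue \<Otimes>\<^sub>M lebesgue))
           + (\<integral>x. g (u x) * \<phi> x \<partial>lebesgue_on \<Omega>)
           = (\<integral>x. real_of_ereal (h (u x)) * f x * \<phi> x \<partial>lebesgue_on \<Omega>)))"

end

theory Submission
  imports Defs
begin

text \<open>
  Let \<open>w = u1 - u2\<close>. Subtracting the equations, \<open>w\<close> solves \<open>- \<Delta> w + (- \<Delta>)\<^sup>s w = F\<close> weakly, where
  \<open>F = (h(u1) - h(u2)) f - (g(u1) - g(u2))\<close> is only locally integrable but satisfies \<open>F w \<le> 0\<close>
  by monotonicity. To test with a function of \<open>w\<close> although \<open>F\<close> is not globally integrable, take test
  functions \<open>\<psi> j \<rightarrow> w\<close> in \<open>H\<^sub>0\<^sup>1\<close> and the smooth bounded function \<open>\<Phi>(t, p) = t p\<^sup>2 / (1 + t\<^sup>2 + p\<^sup>2)\<close>,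
  which has the sign of \<open>t\<close>, vanishes at \<open>p = 0\<close> and has first derivatives bounded by 1. Then
  \<open>\<Phi>(\<psi> j, \<psi> k)\<close> is an admissible test function supported in the support of \<open>\<psi> k\<close>. As \<open>j \<rightarrow> \<infinity>\<close> the
  right-hand side tends to the integral of \<open>F \<Phi>(w, \<psi> k) \<le> 0\<close>, and then \<open>k \<rightarrow> \<infinity>\<close> in the energy terms
  leaves a nonpositive sum of a local and a nonlocal form evaluated at \<open>w\<close> and \<open>\<eta>(w)\<close> with
  \<open>\<eta>(t) = \<Phi>(t, t)\<close> strictly increasing. Both forms are nonnegative, so the nonlocal one vanishes, \<open>w\<close> is
  constant almost everywhere, and it is zero outside a bounded set.
\<close>

section \<open>Test functions\<close>

text \<open>Only smooth compactly supported test functions are admissible, so neither the difference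
  of two solutions nor a Lipschitz truncation built with a minimum can be inserted in the equation.
  This is why Phi is rational: sums, products and inverses suffice for its smoothness, and the 1 in
  the denominator keeps it from vanishing. The factor p^2 localises without affecting the sign, and
  division by 1 + t^2 + p^2 gives |Phi(t, p)| <= |p| whatever t is, hence a majorant of the source
  term that does not depend on j. The derivative bounds replace a chain rule for Sobolev functions:
  only smooth functions are ever composed with Phi, and their gradients pass to the limit under the
  majorant |grad psi_j| + |grad psi_k|; the Lipschitz bound does the same for difference quotients.
  That w has finite nonlocal energy is itself a limit statement: the H^1 norm controls the
  fractional energy of smooth functions, and Fatou carries this to w. The nonlocal form is the one
  that concludes, since its vanishing gives constancy directly, and a nonzero constant would make a
  bounded set almost all of space.\<close>

lemma dderiv_append: "dderiv (vs @ ws) f = dderiv vs (dderiv ws f)"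
  by (induction vs) auto

text \<open>Induction on the list of directions keeps every iterated derivative inside
  \<open>P\<close>; continuity of each of them then comes from its differentiability.\<close>

lemma smooth_on_coinduct:
  assumes "P f"
    and diff: "\<And>f x. P f \<Longrightarrow> f differentiable (at x)"
    and step: "\<And>f v. P f \<Longrightarrow> P (\<lambda>x. frechet_derivative f (at x) v)"
  shows "smooth_on UNIV f"
proof -
  have P: "P (dderiv vs f)" for vs
    by (induction vs) (simp only: dderiv.simps, rule \<open>P f\<close>, simp only: dderiv.simps, rule step)
  show ?thesis
    unfolding smooth_on_def
    using diff[OF P] by (simp add: differentiable_imp_continuous_on differentiable_at_imp_differentiable_on)
qed

lemma smooth_on_differentiable: "smooth_on UNIV f \<Longrightarrow> f differentiable (at x)"
  unfolding smooth_on_def by (drule spec[of _ "[]"]) simp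

lemma smooth_on_has_derivative:
  "smooth_on UNIV f \<Longrightarrow> (f has_derivative frechet_derivative f (at x)) (at x)"
  using smooth_on_differentiable frechet_derivative_works by blast

lemma smooth_on_continuous: "smooth_on UNIV f \<Longrightarrow> continuous_on UNIV f"
  unfolding smooth_on_def by (drule spec[of _ "[]"]) simp

lemma smooth_on_frechet_derivative:
  assumes "smooth_on UNIV f"
  shows "smooth_on UNIV (\<lambda>x. frechet_derivative f (at x) v)"
proof -
  have "dderiv vs (\<lambda>x. frechet_derivative f (at x) v) = dderiv (vs @ [v]) f" for vs
    by (simp add: dderiv_append)
  then show ?thesis using assms unfolding smooth_on_def by simp
qed

text \<open>The rules are chosen so that the class is stable under differentiation: the product and
  quotient rules give expressions of the same kind. Higher order Leibniz formulas are thereby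
  avoided, and the operations are just those in which \<open>cutoff\<close> can be written.\<close>

inductive smooth_algebra :: "('a::euclidean_space \<Rightarrow> real) \<Rightarrow> bool" where
  base: "smooth_on UNIV f \<Longrightarrow> smooth_algebra f"
| const: "smooth_algebra (\<lambda>x. c)"
| add: "smooth_algebra f \<Longrightarrow> smooth_algebra g \<Longrightarrow> smooth_algebra (\<lambda>x. f x + g x)"
| mult: "smooth_algebra f \<Longrightarrow> smooth_algebra g \<Longrightarrow> smooth_algebra (\<lambda>x. f x * g x)"
| inverse: "smooth_algebra f \<Longrightarrow> (\<And>x. f x \<noteq> 0) \<Longrightarrow> smooth_algebra (\<lambda>x. inverse (f x))"

lemma smooth_algebra_derivative:
  assumes "smooth_algebra f"
  shows "(\<forall>x. f differentiable (at x)) \<and> (\<forall>v. smooth_algebra (\<lambda>x. frechet_derivative f (at x) v))"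
  using assms
proof induction
  case (base f)
  then show ?case
    by (simp add: smooth_on_differentiable smooth_on_frechet_derivative smooth_algebra.base)
next
  case (const c)
  then show ?case by (simp add: smooth_algebra.const)
next
  case (add f g)
  then have "((\<lambda>x. f x + g x) has_derivative (\<lambda>v. frechet_derivative f (at x) v + frechet_derivative g (at x) v)) (at x)" for x
    by (auto intro!: derivative_intros simp: frechet_derivative_works)
  then have "frechet_derivative (\<lambda>x. f x + g x) (at x) = (\<lambda>v. frechet_derivative f (at x) v + frechet_derivative g (at x) v)" for x
    by (rule frechet_derivative_at[symmetric])
  then show ?case using add by (simp add: smooth_algebra.add)
next
  case (mult f g)
  then have "((\<lambda>x. f x * g x) has_derivative (\<lambda>v. f x * frechet_derivative g (at x) v + frechet_derivative f (at x) v * g x)) (at x)" for x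
    by (auto intro!: derivative_intros simp: frechet_derivative_works)
  then have "frechet_derivative (\<lambda>x. f x * g x) (at x) = (\<lambda>v. f x * frechet_derivative g (at x) v + frechet_derivative f (at x) v * g x)" for x
    by (rule frechet_derivative_at[symmetric])
  then show ?case using mult by (simp add: smooth_algebra.add smooth_algebra.mult)
next
  case (inverse f)
  then have "((\<lambda>x. inverse (f x)) has_derivative (\<lambda>v. - (inverse (f x) * frechet_derivative f (at x) v * inverse (f x)))) (at x)" for x
    by (auto intro!: derivative_intros simp: frechet_derivative_works)
  \<comment> \<open>The minus sign is written as the factor \<open>-1\<close> so that the
    \<open>const\<close> and \<open>mult\<close> rules cover the derivative.\<close>
  then have "frechet_derivative (\<lambda>x. inverse (f x)) (at x) = (\<lambda>v. (-1) * (inverse (f x) * frechet_derivative f (at x) v * inverse (f x)))" for x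
    by (subst frechet_derivative_at[symmetric]) (auto simp: fun_eq_iff)
  moreover have "smooth_algebra (\<lambda>x. (-1) * (inverse (f x) * frechet_derivative f (at x) v * inverse (f x)))" for v
    using inverse by (intro smooth_algebra.const smooth_algebra.mult smooth_algebra.inverse) auto
  moreover have "(\<lambda>x. inverse (f x)) differentiable (at x)" for x
    using inverse by (auto intro!: derivative_intros)
  ultimately show ?case by (simp only: simp_thms)
qed

text \<open>The coinduction principle applies to the class itself, so its introduction rules become
  closure rules for \<open>smooth_on UNIV\<close>.\<close>

lemma smooth_algebra_iff: "smooth_algebra f \<longleftrightarrow> smooth_on UNIV f"
proof
  show "smooth_on UNIV f" if "smooth_algebra f"
    by (rule smooth_on_coinduct[of smooth_algebra, OF that]) (simp_all add: smooth_algebra_derivative)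
qed (rule smooth_algebra.base)

lemmas smooth_on_algebra_intros = smooth_algebra.intros(2-)[unfolded smooth_algebra_iff]

lemma smooth_on_uminus:
  assumes "smooth_on UNIV f" shows "smooth_on UNIV (\<lambda>x. - f x)"
  using smooth_on_algebra_intros(3)[OF smooth_on_algebra_intros(1)[of "-1"] assms] by simp

lemma smooth_on_diff:
  assumes "smooth_on UNIV f" "smooth_on UNIV g" shows "smooth_on UNIV (\<lambda>x. f x - g x)"
  using smooth_on_algebra_intros(2)[OF assms(1) smooth_on_uminus[OF assms(2)]] by simp

section \<open>Supports, bounds and closure properties of test functions\<close>

lemma test_fun_smooth: "test_fun U \<phi> \<Longrightarrow> smooth_on UNIV \<phi>"
  by (simp add: test_fun_def)

lemma test_fun_compact_support: "test_fun U \<phi> \<Longrightarrow> compact (closure {x. \<phi> x \<noteq> 0})"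
  by (simp add: test_fun_def)

lemma test_fun_support: "test_fun U \<phi> \<Longrightarrow> closure {x. \<phi> x \<noteq> 0} \<subseteq> U"
  by (simp add: test_fun_def)

lemma test_fun_eq_0: "test_fun U \<phi> \<Longrightarrow> x \<notin> U \<Longrightarrow> \<phi> x = 0"
  using test_fun_support[of U \<phi>] closure_subset[of "{x. \<phi> x \<noteq> 0}"] by (metis (mono_tags) mem_Collect_eq subsetD)

lemma test_fun_mono: "test_fun U \<phi> \<Longrightarrow> U \<subseteq> V \<Longrightarrow> test_fun V \<phi>"
  unfolding test_fun_def by blast

lemma test_funI:
  assumes "smooth_on UNIV f" "closed K" "compact K" "K \<subseteq> U" "\<And>x. x \<notin> K \<Longrightarrow> f x = 0"
  shows "test_fun U f"
proof -
  have "closure {x. f x \<noteq> 0} \<subseteq> K"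
    using assms(2,5) by (intro closure_minimal) auto
  moreover from this have "compact (closure {x. f x \<noteq> 0})"
    using compact_Int_closed[OF \<open>compact K\<close> closed_closure, of "{x. f x \<noteq> 0}"] by (simp only: inf.absorb2)
  moreover note \<open>K \<subseteq> U\<close> \<open>smooth_on UNIV f\<close>
  ultimately show ?thesis unfolding test_fun_def by blast
qed

lemma test_fun_diff:
  assumes "test_fun U f" "test_fun U g"
  shows "test_fun U (\<lambda>x. f x - g x)"
proof (rule test_funI)
  show "smooth_on UNIV (\<lambda>x. f x - g x)"
    using assms by (intro smooth_on_diff test_fun_smooth)
  show "compact (closure {x. f x \<noteq> 0} \<union> closure {x. g x \<noteq> 0})"
    using assms by (intro compact_Un test_fun_compact_support)
  show "closure {x. f x \<noteq> 0} \<union> closure {x. g x \<noteq> 0} \<subseteq> U"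
    using test_fun_support[OF assms(1)] test_fun_support[OF assms(2)] by (rule Un_least)
next
  fix x assume "x \<notin> closure {x. f x \<noteq> 0} \<union> closure {x. g x \<noteq> 0}"
  then have "x \<notin> {x. f x \<noteq> 0}" "x \<notin> {x. g x \<noteq> 0}" using closure_subset[of "{x. f x \<noteq> 0}"] closure_subset[of "{x. g x \<noteq> 0}"] by blast+
  then show "f x - g x = 0" by auto
qed (simp add: closed_Un)

text \<open>The complement of the support is open and the function is zero on it, so the derivative
  vanishes there as well. Partial derivatives may thus serve as test functions themselves.\<close>

lemma test_fun_frechet_derivative:
  assumes "test_fun U f"
  shows "test_fun U (\<lambda>x. frechet_derivative f (at x) v)"
proof (rule test_funI)
  show "smooth_on UNIV (\<lambda>x. frechet_derivative f (at x) v)"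
    using assms by (intro smooth_on_frechet_derivative test_fun_smooth)
  show "compact (closure {x. f x \<noteq> 0})" "closure {x. f x \<noteq> 0} \<subseteq> U"
    using test_fun_compact_support[OF assms] test_fun_support[OF assms] by simp_all
  fix x assume x: "x \<notin> closure {x. f x \<noteq> 0}"
  have "(f has_derivative (\<lambda>_. 0)) (at x)"
  proof (rule has_derivative_transform_within_open)
    show "((\<lambda>_. 0) has_derivative (\<lambda>_. 0)) (at x)" by simp
    show "open (- closure {x. f x \<noteq> 0})" by auto
    show "x \<in> - closure {x. f x \<noteq> 0}" using x by auto
    show "0 = f y" if "y \<in> - closure {x. f x \<noteq> 0}" for y
    proof -
      have "y \<notin> {x. f x \<noteq> 0}" using that closure_subset[of "{x. f x \<noteq> 0}"] by blast
      then show ?thesis by auto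
    qed
  qed
  from frechet_derivative_at[OF this, symmetric] show "frechet_derivative f (at x) v = 0"
    by simp
qed (rule closed_closure)

lemma test_fun_continuous: "test_fun U f \<Longrightarrow> continuous_on UNIV f"
  by (simp add: smooth_on_continuous test_fun_smooth)

lemma test_fun_lebesgue: "test_fun U f \<Longrightarrow> f \<in> borel_measurable lebesgue"
  by (simp add: borel_measurable_continuous_onI test_fun_continuous measurable_completion)

lemma test_fun_bounded:
  assumes "test_fun U f" obtains B where "\<And>x. \<bar>f x\<bar> \<le> B"
proof -
  have "compact (f ` closure {x. f x \<noteq> 0})"
    by (intro compact_continuous_image continuous_on_subset[OF test_fun_continuous[OF assms]]
        test_fun_compact_support[OF assms]) auto
  then obtain B where B: "\<And>y. y \<in> f ` closure {x. f x \<noteq> 0} \<Longrightarrow> norm y \<le> B"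
    by (meson compact_imp_bounded bounded_iff)
  \<comment> \<open>\<open>B\<close> bounds the values on the support only and may be negative if
    the support is empty; the maximum also covers the points where \<open>f\<close> is zero.\<close>
  have "\<bar>f x\<bar> \<le> max B 0" for x
  proof (cases "f x = 0")
    case False
    then have "x \<in> closure {x. f x \<noteq> 0}" using closure_subset[of "{x. f x \<noteq> 0}"] by blast
    then have "norm (f x) \<le> B" by (intro B imageI)
    then show ?thesis by simp
  qed auto
  then show ?thesis by (rule that)
qed

lemma test_fun_square_integrable:
  assumes "test_fun U f" shows "integrable lebesgue (\<lambda>x. (f x)\<^sup>2)"
proof -
  obtain B where B: "\<And>x. \<bar>f x\<bar> \<le> B" using test_fun_bounded[OF assms] by metis
  let ?K = "closure {x. f x \<noteq> 0}"
  have K: "?K \<in> lmeasurable"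
    by (intro lmeasurable_compact test_fun_compact_support[OF assms])
  show ?thesis
  proof (rule Bochner_Integration.integrable_bound)
    show "integrable lebesgue (\<lambda>x. B\<^sup>2 * indicator ?K x :: real)"
      using K by (intro integrable_mult_right integrable_real_indicator) (auto simp: fmeasurable_def)
    show "(\<lambda>x. (f x)\<^sup>2) \<in> borel_measurable lebesgue"
      using test_fun_lebesgue[OF assms] by measurable
    have "(f x)\<^sup>2 \<le> B\<^sup>2 * indicator ?K x" for x
    proof (cases "f x = 0")
      case False
      then have "x \<in> ?K" using closure_subset[of "{x. f x \<noteq> 0}"] by blast
      then show ?thesis using power_mono[OF B[of x] abs_ge_zero, of 2] by simp
    qed auto
    then show "AE x in lebesgue. norm ((f x)\<^sup>2) \<le> norm (B\<^sup>2 * indicator ?K x :: real)"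
      by (auto simp: abs_of_nonneg)
  qed
qed

section \<open>Pairings in \<open>L\<^sup>2\<close>\<close>

lemma integrable_mult_of_squares:
  fixes f g :: "'b \<Rightarrow> real"
  assumes [measurable]: "f \<in> borel_measurable M" "g \<in> borel_measurable M"
    and "integrable M (\<lambda>x. (f x)\<^sup>2)" "integrable M (\<lambda>x. (g x)\<^sup>2)"
  shows "integrable M (\<lambda>x. f x * g x)"
proof (rule Bochner_Integration.integrable_bound)
  show "integrable M (\<lambda>x. (f x)\<^sup>2 + (g x)\<^sup>2)" using assms by simp
  have "\<bar>f x * g x\<bar> \<le> (f x)\<^sup>2 + (g x)\<^sup>2" for x
  proof -
    have "2 * (\<bar>f x\<bar> * \<bar>g x\<bar>) \<le> (f x)\<^sup>2 + (g x)\<^sup>2"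
      using sum_squares_bound[of "\<bar>f x\<bar>" "\<bar>g x\<bar>"] by simp
    moreover have "0 \<le> \<bar>f x\<bar> * \<bar>g x\<bar>" by simp
    ultimately show ?thesis unfolding abs_mult by linarith
  qed
  then show "AE x in M. norm (f x * g x) \<le> norm ((f x)\<^sup>2 + (g x)\<^sup>2)"
    by (intro always_eventually) (simp add: abs_of_nonneg)
qed measurable

lemma integrable_square_diff:
  fixes f g :: "'b \<Rightarrow> real"
  assumes [measurable]: "f \<in> borel_measurable M" "g \<in> borel_measurable M"
    and "integrable M (\<lambda>x. (f x)\<^sup>2)" "integrable M (\<lambda>x. (g x)\<^sup>2)"
  shows "integrable M (\<lambda>x. (f x - g x)\<^sup>2)"
  using integrable_mult_of_squares[OF assms] assms(3,4)
  by (simp add: power2_diff mult.assoc)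

text \<open>A weighted Young inequality takes the place of Cauchy-Schwarz: |b d| is at most
  (\<delta>/2) b^2 + d^2/(2\<delta>), where \<delta> makes the first integral small and a large
  index then the second.\<close>

lemma tendsto_integral_mult_L2:
  fixes b :: "'b \<Rightarrow> real"
  assumes [measurable]: "b \<in> borel_measurable M" "\<And>j. d j \<in> borel_measurable M"
    and b: "integrable M (\<lambda>x. (b x)\<^sup>2)"
    and d: "\<And>j. integrable M (\<lambda>x. (d j x)\<^sup>2)"
    and lim: "(\<lambda>j. \<integral>x. (d j x)\<^sup>2 \<partial>M) \<longlonglongrightarrow> 0"
  shows "(\<lambda>j. \<integral>x. \<bar>b x\<bar> * \<bar>d j x\<bar> \<partial>M) \<longlonglongrightarrow> 0"
proof (rule LIMSEQ_I)
  fix e :: real assume e: "0 < e"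
  define I where "I = (\<integral>x. (b x)\<^sup>2 \<partial>M)"
  have I: "0 \<le> I" unfolding I_def by simp
  \<comment> \<open>The summand 1 allows \<open>I = 0\<close> and gives \<delta> I < e; with the
    error below e \<delta>, the two terms are at most \<delta> I / 2 and e / 2.\<close>
  define \<delta> where "\<delta> = e / (I + 1)"
  have \<delta>: "0 < \<delta>" "\<delta> * I < e" using e I by (auto simp: \<delta>_def field_simps add_pos_nonneg)
  have "0 < e * \<delta>" using e \<delta> by simp
  then obtain N where N: "\<And>j. N \<le> j \<Longrightarrow> \<bar>\<integral>x. (d j x)\<^sup>2 \<partial>M\<bar> < e * \<delta>"
    using LIMSEQ_D[OF lim, of "e * \<delta>"] by auto
  have "norm ((\<integral>x. \<bar>b x\<bar> * \<bar>d j x\<bar> \<partial>M) - 0) < e" if "N \<le> j" for j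
  proof -
    have pt: "\<bar>b x\<bar> * \<bar>d j x\<bar> \<le> \<delta> / 2 * (b x)\<^sup>2 + 1 / (2 * \<delta>) * (d j x)\<^sup>2" for x
    proof -
      have "0 \<le> (\<delta> * \<bar>b x\<bar> - \<bar>d j x\<bar>)\<^sup>2 / (2 * \<delta>)" using \<delta> by simp
      also have "\<dots> = \<delta> / 2 * (b x)\<^sup>2 + 1 / (2 * \<delta>) * (d j x)\<^sup>2 - \<bar>b x\<bar> * \<bar>d j x\<bar>"
        using \<delta> by (simp add: power2_diff field_simps power2_eq_square flip: abs_mult)
      finally show ?thesis by simp
    qed
    have "integrable M (\<lambda>x. \<bar>b x\<bar> * \<bar>d j x\<bar>)"
      using integrable_norm[OF integrable_mult_of_squares[OF _ _ b d]] by (simp add: abs_mult)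
    then have "(\<integral>x. \<bar>b x\<bar> * \<bar>d j x\<bar> \<partial>M) \<le> (\<integral>x. \<delta> / 2 * (b x)\<^sup>2 + 1 / (2 * \<delta>) * (d j x)\<^sup>2 \<partial>M)"
      using b d pt by (intro integral_mono) auto
    also have "\<dots> = \<delta> / 2 * I + 1 / (2 * \<delta>) * (\<integral>x. (d j x)\<^sup>2 \<partial>M)"
      using b d by (simp add: I_def)
    also have "1 / (2 * \<delta>) * (\<integral>x. (d j x)\<^sup>2 \<partial>M) \<le> 1 / (2 * \<delta>) * (e * \<delta>)"
      using N[OF that] \<delta> by (intro mult_left_mono) auto
    also have "\<delta> / 2 * I + 1 / (2 * \<delta>) * (e * \<delta>) < e"
      using \<delta> by simp
    finally show ?thesis by simp
  qed
  then show "\<exists>no. \<forall>n\<ge>no. norm ((\<integral>x. \<bar>b x\<bar> * \<bar>d n x\<bar> \<partial>M) - 0) < e" by blast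
qed

text \<open>A generalised dominated convergence: the majorant \<open>\<bar>a j\<bar> + \<bar>c\<bar>\<close> may depend on \<open>j\<close>
  as long as it converges in \<open>L\<^sup>2\<close>.\<close>

lemma tendsto_integral_mult_L2_dominated:
  fixes b :: "'b \<Rightarrow> real"
  assumes [measurable]: "b \<in> borel_measurable M" "a \<in> borel_measurable M" "c \<in> borel_measurable M"
      "\<And>j. A j \<in> borel_measurable M" "\<And>j. T j \<in> borel_measurable M" "S \<in> borel_measurable M"
    and b: "integrable M (\<lambda>x. (b x)\<^sup>2)" and a: "integrable M (\<lambda>x. (a x)\<^sup>2)"
    and c: "integrable M (\<lambda>x. (c x)\<^sup>2)"
    and A: "\<And>j. integrable M (\<lambda>x. (A j x - a x)\<^sup>2)"
    and lim: "(\<lambda>j. \<integral>x. (A j x - a x)\<^sup>2 \<partial>M) \<longlonglongrightarrow> 0"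
    and T: "\<And>j. AE x in M. \<bar>T j x\<bar> \<le> \<bar>A j x\<bar> + \<bar>c x\<bar>"
    and S: "AE x in M. \<bar>S x\<bar> \<le> \<bar>a x\<bar> + \<bar>c x\<bar>"
    and TS: "AE x in M. (\<lambda>j. T j x) \<longlonglongrightarrow> S x"
  shows "integrable M (\<lambda>x. b x * T j x)" and "integrable M (\<lambda>x. b x * S x)"
    and "(\<lambda>j. \<integral>x. b x * T j x \<partial>M) \<longlonglongrightarrow> (\<integral>x. b x * S x \<partial>M)"
proof -
  define m where "m x = \<bar>b x\<bar> * (\<bar>a x\<bar> + \<bar>c x\<bar>)" for x
  have [measurable]: "m \<in> borel_measurable M" unfolding m_def by measurable
  have m: "integrable M m"
    unfolding m_def
    using integrable_norm[OF integrable_mult_of_squares[OF _ _ b a]]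
      integrable_norm[OF integrable_mult_of_squares[OF _ _ b c]]
    by (simp add: abs_mult distrib_left)
  have iS: "integrable M (\<lambda>x. b x * S x)"
  proof (rule Bochner_Integration.integrable_bound[OF m])
    show "AE x in M. norm (b x * S x) \<le> norm (m x)"
      using S by eventually_elim (auto simp: m_def abs_mult intro!: mult_left_mono)
  qed measurable
  then show "integrable M (\<lambda>x. b x * S x)" .
  have bA: "integrable M (\<lambda>x. \<bar>b x\<bar> * \<bar>A j x - a x\<bar>)" for j
    using integrable_norm[OF integrable_mult_of_squares[OF _ _ b A]] by (simp add: abs_mult)
  have iT: "integrable M (\<lambda>x. b x * T j x)" for j
  proof (rule Bochner_Integration.integrable_bound)
    show "integrable M (\<lambda>x. \<bar>b x\<bar> * \<bar>A j x - a x\<bar> + m x)" using bA m by simp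
    show "AE x in M. norm (b x * T j x) \<le> norm (\<bar>b x\<bar> * \<bar>A j x - a x\<bar> + m x)"
      using T[of j]
    proof eventually_elim
      case (elim x)
      have "\<bar>b x\<bar> * \<bar>T j x\<bar> \<le> \<bar>b x\<bar> * (\<bar>A j x - a x\<bar> + (\<bar>a x\<bar> + \<bar>c x\<bar>))"
        using elim by (intro mult_left_mono) auto
      also have "\<dots> = \<bar>b x\<bar> * \<bar>A j x - a x\<bar> + m x" by (simp add: m_def algebra_simps)
      finally show ?case by (simp add: abs_mult)
    qed
  qed measurable
  then show "integrable M (\<lambda>x. b x * T j x)" .
  \<comment> \<open>Since |T - S| is at most |A - a| + 2 (|a| + |c|), the product |b| |T - S| is at
    most |b| |A - a| plus this truncation at \<open>2 * m\<close>. The first part tends to 0 by the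
    pairing lemma, the second by ordinary dominated convergence.\<close>
  define r where "r j x = min (\<bar>b x\<bar> * \<bar>T j x - S x\<bar>) (2 * m x)" for j x
  have [measurable]: "r j \<in> borel_measurable M" for j unfolding r_def by measurable
  have m0: "0 \<le> m x" for x by (simp add: m_def)
  have r: "(\<lambda>j. \<integral>x. r j x \<partial>M) \<longlonglongrightarrow> (\<integral>x. 0 \<partial>M)"
  proof (rule integral_dominated_convergence)
    show "integrable M (\<lambda>x. 2 * m x)" using m by simp
    show "AE x in M. norm (r j x) \<le> 2 * m x" for j
      using m0 by (auto simp: r_def)
    show "AE x in M. (\<lambda>j. r j x) \<longlonglongrightarrow> 0"
      using TS
    proof eventually_elim
      case (elim x)
      have "(\<lambda>j. r j x) \<longlonglongrightarrow> min (\<bar>b x\<bar> * \<bar>S x - S x\<bar>) (2 * m x)"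
        unfolding r_def by (intro tendsto_intros elim)
      then show ?case using m0[of x] by simp
    qed
  qed measurable
  have ir: "integrable M (r j)" for j
    by (rule Bochner_Integration.integrable_bound[of M "\<lambda>x. 2 * m x"]) (use m m0 in \<open>auto simp: r_def\<close>)
  have lim': "(\<lambda>j. (\<integral>x. \<bar>b x\<bar> * \<bar>A j x - a x\<bar> \<partial>M) + (\<integral>x. r j x \<partial>M)) \<longlonglongrightarrow> 0 + 0"
    using r by (intro tendsto_add tendsto_integral_mult_L2 b A lim) (simp, simp, simp)
  have "(\<lambda>j. (\<integral>x. b x * T j x \<partial>M) - (\<integral>x. b x * S x \<partial>M)) \<longlonglongrightarrow> 0"
  proof (rule Lim_null_comparison)
    show "(\<lambda>j. (\<integral>x. \<bar>b x\<bar> * \<bar>A j x - a x\<bar> \<partial>M) + (\<integral>x. r j x \<partial>M)) \<longlonglongrightarrow> 0"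
      using lim' by simp
    have "norm ((\<integral>x. b x * T j x \<partial>M) - (\<integral>x. b x * S x \<partial>M))
        \<le> (\<integral>x. \<bar>b x\<bar> * \<bar>A j x - a x\<bar> \<partial>M) + (\<integral>x. r j x \<partial>M)" for j
    proof -
      have "norm ((\<integral>x. b x * T j x \<partial>M) - (\<integral>x. b x * S x \<partial>M)) = norm (\<integral>x. b x * T j x - b x * S x \<partial>M)"
        using iT iS by simp
      also have "\<dots> \<le> (\<integral>x. norm (b x * T j x - b x * S x) \<partial>M)"
        by (rule integral_norm_bound)
      also have "\<dots> \<le> (\<integral>x. \<bar>b x\<bar> * \<bar>A j x - a x\<bar> + r j x \<partial>M)"
      proof (rule integral_mono_AE)
        show "integrable M (\<lambda>x. norm (b x * T j x - b x * S x))" using iT iS by simp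
        show "integrable M (\<lambda>x. \<bar>b x\<bar> * \<bar>A j x - a x\<bar> + r j x)" using bA ir by simp
        show "AE x in M. norm (b x * T j x - b x * S x) \<le> \<bar>b x\<bar> * \<bar>A j x - a x\<bar> + r j x"
          using T[of j] S
        proof eventually_elim
          case (elim x)
          have e: "norm (b x * T j x - b x * S x) = \<bar>b x\<bar> * \<bar>T j x - S x\<bar>"
            by (simp add: abs_mult flip: right_diff_distrib)
          have "\<bar>T j x - S x\<bar> \<le> \<bar>A j x - a x\<bar> + 2 * (\<bar>a x\<bar> + \<bar>c x\<bar>)"
            using elim abs_triangle_ineq4[of "T j x" "S x"] abs_triangle_ineq[of "A j x - a x" "a x"]
            by simp
          then have "\<bar>b x\<bar> * \<bar>T j x - S x\<bar> \<le> \<bar>b x\<bar> * (\<bar>A j x - a x\<bar> + 2 * (\<bar>a x\<bar> + \<bar>c x\<bar>))"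
            by (intro mult_left_mono) auto
          also have "\<dots> = \<bar>b x\<bar> * \<bar>A j x - a x\<bar> + 2 * m x" by (simp add: m_def algebra_simps)
          moreover have "0 \<le> \<bar>b x\<bar> * \<bar>A j x - a x\<bar>" by simp
          ultimately show ?case unfolding e r_def by linarith
        qed
      qed
      also have "\<dots> = (\<integral>x. \<bar>b x\<bar> * \<bar>A j x - a x\<bar> \<partial>M) + (\<integral>x. r j x \<partial>M)"
        using bA ir by simp
      finally show ?thesis .
    qed
    then show "\<forall>\<^sub>F j in sequentially. norm ((\<integral>x. b x * T j x \<partial>M) - (\<integral>x. b x * S x \<partial>M))
        \<le> (\<integral>x. \<bar>b x\<bar> * \<bar>A j x - a x\<bar> \<partial>M) + (\<integral>x. r j x \<partial>M)"
      by (rule always_eventually[rule_format])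
  qed
  then show "(\<lambda>j. \<integral>x. b x * T j x \<partial>M) \<longlonglongrightarrow> (\<integral>x. b x * S x \<partial>M)"
    by (simp add: LIM_zero_iff)
qed

section \<open>The truncation\<close>

text \<open>This is Phi of the overview: \<open>t\<close> will be the difference of the solutions or
  its approximation, \<open>p\<close> the localising approximation.\<close>

definition cutoff :: "real \<Rightarrow> real \<Rightarrow> real" where
  "cutoff t p = t * p\<^sup>2 / (1 + t\<^sup>2 + p\<^sup>2)"

definition cutoff_dt :: "real \<Rightarrow> real \<Rightarrow> real" where
  "cutoff_dt t p = p\<^sup>2 * (1 + p\<^sup>2 - t\<^sup>2) / (1 + t\<^sup>2 + p\<^sup>2)\<^sup>2"

definition cutoff_dp :: "real \<Rightarrow> real \<Rightarrow> real" where
  "cutoff_dp t p = 2 * t * p * (1 + t\<^sup>2) / (1 + t\<^sup>2 + p\<^sup>2)\<^sup>2"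

lemma cutoff_denominator_pos: "0 < 1 + t\<^sup>2 + p\<^sup>2" for t p :: real
  by (simp add: add_pos_nonneg)

lemma cutoff_0: "cutoff t 0 = 0"
  by (simp add: cutoff_def)

lemma cutoff_nonpos_of_mult: "F * t \<le> 0 \<Longrightarrow> F * cutoff t p \<le> 0"
proof -
  assume "F * t \<le> 0"
  then have "(F * t) * (p\<^sup>2 / (1 + t\<^sup>2 + p\<^sup>2)) \<le> 0"
    using cutoff_denominator_pos[of t p] by (intro mult_nonpos_nonneg[of "F * t"]) auto
  then show ?thesis by (simp add: cutoff_def mult.assoc)
qed

lemma abs_mult_le_cutoff_denominator: "2 * \<bar>t * p\<bar> \<le> 1 + t\<^sup>2 + p\<^sup>2" for t p :: real
  using sum_squares_bound[of "\<bar>t\<bar>" "\<bar>p\<bar>"] by (simp add: abs_mult)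

text \<open>The product |t p| never exceeds the denominator, so \<open>t\<close> disappears from the
  bound. This uniformity controls the source while the first argument is still varying.\<close>

lemma abs_cutoff_le: "\<bar>cutoff t p\<bar> \<le> \<bar>p\<bar>"
proof -
  have "\<bar>t * p\<bar> * \<bar>p\<bar> \<le> (1 + t\<^sup>2 + p\<^sup>2) * \<bar>p\<bar>"
    using abs_mult_le_cutoff_denominator[of t p] by (intro mult_right_mono) auto
  then show ?thesis using cutoff_denominator_pos[of t p]
    by (simp add: cutoff_def abs_mult field_simps power2_eq_square)
qed

text \<open>The numerator is a product of two factors, each at most 1 + t^2 + p^2 in absolute value,
  over the square of that quantity. The same splitting, with factors 2 t p and 1 + t^2, handles
  \<open>cutoff_dp\<close>.\<close>

lemma abs_cutoff_dt_le: "\<bar>cutoff_dt t p\<bar> \<le> 1"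
proof -
  have "\<bar>p\<^sup>2 * (1 + p\<^sup>2 - t\<^sup>2)\<bar> = p\<^sup>2 * \<bar>1 + p\<^sup>2 - t\<^sup>2\<bar>" by (simp add: abs_mult)
  also have "\<dots> \<le> (1 + t\<^sup>2 + p\<^sup>2) * (1 + t\<^sup>2 + p\<^sup>2)"
    by (intro mult_mono) (auto simp: abs_le_iff)
  finally show ?thesis using cutoff_denominator_pos[of t p]
    by (simp add: cutoff_dt_def power2_eq_square)
qed

lemma abs_cutoff_dp_le: "\<bar>cutoff_dp t p\<bar> \<le> 1"
proof -
  have "\<bar>2 * t * p * (1 + t\<^sup>2)\<bar> = (2 * \<bar>t * p\<bar>) * (1 + t\<^sup>2)" by (simp add: abs_mult)
  also have "\<dots> \<le> (1 + t\<^sup>2 + p\<^sup>2) * (1 + t\<^sup>2 + p\<^sup>2)"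
    using abs_mult_le_cutoff_denominator by (intro mult_mono) auto
  finally show ?thesis using cutoff_denominator_pos[of t p]
    by (simp add: cutoff_dp_def power2_eq_square)
qed

text \<open>The combination is the chain rule for a composite with \<open>cutoff\<close>, one
  coordinate at a time; the bound is the majorant required by the generalised dominated
  convergence.\<close>

lemma abs_cutoff_combination_le: "\<bar>cutoff_dt t p * a + cutoff_dp t p * b\<bar> \<le> \<bar>a\<bar> + \<bar>b\<bar>"
proof -
  have "\<bar>cutoff_dt t p\<bar> * \<bar>a\<bar> \<le> 1 * \<bar>a\<bar>" "\<bar>cutoff_dp t p\<bar> * \<bar>b\<bar> \<le> 1 * \<bar>b\<bar>"
    by (intro mult_right_mono abs_cutoff_dt_le abs_cutoff_dp_le; simp)+
  then show ?thesis
    using abs_triangle_ineq[of "cutoff_dt t p * a" "cutoff_dp t p * b"] by (simp add: abs_mult)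
qed

lemma cutoff_dt_derivative: "((\<lambda>t. cutoff t p) has_real_derivative cutoff_dt t p) (at t)"
proof -
  have nz: "1 + t\<^sup>2 + p\<^sup>2 \<noteq> 0" using cutoff_denominator_pos[of t p] by simp
  have "((\<lambda>t. t * p\<^sup>2 / (1 + t\<^sup>2 + p\<^sup>2)) has_real_derivative
    (p\<^sup>2 * (1 + t\<^sup>2 + p\<^sup>2) - t * p\<^sup>2 * (2 * t)) / ((1 + t\<^sup>2 + p\<^sup>2) * (1 + t\<^sup>2 + p\<^sup>2))) (at t)"
    using nz by (auto intro!: derivative_eq_intros)
  moreover have "(p\<^sup>2 * (1 + t\<^sup>2 + p\<^sup>2) - t * p\<^sup>2 * (2 * t)) / ((1 + t\<^sup>2 + p\<^sup>2) * (1 + t\<^sup>2 + p\<^sup>2)) = cutoff_dt t p"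
    by (simp add: cutoff_dt_def power2_eq_square algebra_simps)
  ultimately show ?thesis by (simp add: cutoff_def[abs_def])
qed

lemma cutoff_dp_derivative: "((\<lambda>p. cutoff t p) has_real_derivative cutoff_dp t p) (at p)"
proof -
  have nz: "1 + t\<^sup>2 + p\<^sup>2 \<noteq> 0" using cutoff_denominator_pos[of t p] by simp
  have "((\<lambda>p. t * p\<^sup>2 / (1 + t\<^sup>2 + p\<^sup>2)) has_real_derivative
    (t * (2 * p) * (1 + t\<^sup>2 + p\<^sup>2) - t * p\<^sup>2 * (2 * p)) / ((1 + t\<^sup>2 + p\<^sup>2) * (1 + t\<^sup>2 + p\<^sup>2))) (at p)"
    using nz by (auto intro!: derivative_eq_intros)
  moreover have "(t * (2 * p) * (1 + t\<^sup>2 + p\<^sup>2) - t * p\<^sup>2 * (2 * p)) / ((1 + t\<^sup>2 + p\<^sup>2) * (1 + t\<^sup>2 + p\<^sup>2)) = cutoff_dp t p"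
    by (simp add: cutoff_dp_def power2_eq_square algebra_simps)
  ultimately show ?thesis by (simp add: cutoff_def[abs_def])
qed

text \<open>The mean value inequality is used in one variable at a time, passing through the point
  (t', p). For difference quotients it has the role that the bound on the chain rule has for
  gradients.\<close>

lemma cutoff_lipschitz: "\<bar>cutoff t p - cutoff t' p'\<bar> \<le> \<bar>t - t'\<bar> + \<bar>p - p'\<bar>"
proof -
  have "norm (cutoff t p - cutoff t' p) \<le> 1 * norm (t - t')"
    by (rule field_differentiable_bound[of UNIV "\<lambda>t. cutoff t p" "\<lambda>t. cutoff_dt t p"])
      (auto intro: cutoff_dt_derivative abs_cutoff_dt_le)
  moreover have "norm (cutoff t' p - cutoff t' p') \<le> 1 * norm (p - p')"
    by (rule field_differentiable_bound[of UNIV "\<lambda>p. cutoff t' p" "\<lambda>p. cutoff_dp t' p"])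
      (auto intro: cutoff_dp_derivative abs_cutoff_dp_le)
  ultimately show ?thesis by simp
qed

text \<open>On the diagonal the value is t^3 / (1 + 2 t^2), whose derivative vanishes at 0, so
  strictness is obtained by algebra. Strictness is what later turns zero energy into equal
  values.\<close>

lemma cutoff_diagonal_strict_mono: "strict_mono (\<lambda>t. cutoff t t)"
proof (rule strict_monoI)
  fix x y :: real assume "x < y"
  have D: "0 < 1 + 2 * x\<^sup>2" "0 < 1 + 2 * y\<^sup>2" by (simp_all add: add_pos_nonneg)
  \<comment> \<open>Cross-multiplied form of the claim: y^3 - x^3 and the mixed terms share the
    factor y - x.\<close>
  have "y ^ 3 * (1 + 2 * x\<^sup>2) - x ^ 3 * (1 + 2 * y\<^sup>2) = (y - x) * (x\<^sup>2 + x * y + y\<^sup>2 + 2 * (x * y)\<^sup>2)"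
    by (simp add: algebra_simps power2_eq_square power3_eq_cube)
  moreover have "0 < x\<^sup>2 + x * y + y\<^sup>2 + 2 * (x * y)\<^sup>2"
  proof -
    \<comment> \<open>Completing the square; it can vanish only at x = y = 0, which x < y
      excludes.\<close>
    have "0 < (x + y / 2)\<^sup>2 + 3 / 4 * y\<^sup>2"
      using \<open>x < y\<close> by (cases "y = 0") (auto simp: add_nonneg_pos)
    also have "\<dots> = x\<^sup>2 + x * y + y\<^sup>2" by (simp add: power2_eq_square field_simps)
    finally show ?thesis by (simp add: add_pos_nonneg)
  qed
  ultimately have "x ^ 3 * (1 + 2 * y\<^sup>2) < y ^ 3 * (1 + 2 * x\<^sup>2)"
    using \<open>x < y\<close> by (smt (verit) mult_pos_pos)
  then have "x ^ 3 * (1 + 2 * y\<^sup>2) / ((1 + 2 * x\<^sup>2) * (1 + 2 * y\<^sup>2))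
      < y ^ 3 * (1 + 2 * x\<^sup>2) / ((1 + 2 * x\<^sup>2) * (1 + 2 * y\<^sup>2))"
    using D by (intro divide_strict_right_mono mult_pos_pos)
  then have "x ^ 3 / (1 + 2 * x\<^sup>2) < y ^ 3 / (1 + 2 * y\<^sup>2)"
    using D by simp
  moreover have "cutoff t t = t ^ 3 / (1 + 2 * t\<^sup>2)" for t
    by (simp add: cutoff_def power2_eq_square power3_eq_cube mult.assoc add.commute)
  ultimately show "cutoff x x < cutoff y y" by simp
qed

text \<open>At p = t the summands are t^2 and 2 t^2 (1 + t^2), each over (1 + 2 t^2)^2. Their sum is
  the derivative of \<eta>, the weight that the local form acquires in the limit.\<close>

lemma cutoff_derivative_diagonal_nonneg: "0 \<le> cutoff_dt t t + cutoff_dp t t"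
  by (simp add: cutoff_dt_def cutoff_dp_def)

lemma tendsto_cutoff [tendsto_intros]:
  assumes "(f \<longlongrightarrow> t) F" "(g \<longlongrightarrow> p) F"
  shows "((\<lambda>x. cutoff (f x) (g x)) \<longlongrightarrow> cutoff t p) F"
    and "((\<lambda>x. cutoff_dt (f x) (g x)) \<longlongrightarrow> cutoff_dt t p) F"
    and "((\<lambda>x. cutoff_dp (f x) (g x)) \<longlongrightarrow> cutoff_dp t p) F"
proof -
  have nz: "1 + t\<^sup>2 + p\<^sup>2 \<noteq> 0" for t p :: real using cutoff_denominator_pos[of t p] by simp
  show "((\<lambda>x. cutoff (f x) (g x)) \<longlongrightarrow> cutoff t p) F"
    and "((\<lambda>x. cutoff_dt (f x) (g x)) \<longlongrightarrow> cutoff_dt t p) F"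
    and "((\<lambda>x. cutoff_dp (f x) (g x)) \<longlongrightarrow> cutoff_dp t p) F"
    unfolding cutoff_def cutoff_dt_def cutoff_dp_def
    by (intro tendsto_intros assms; simp add: nz)+
qed

lemma borel_measurable_cutoff [measurable (raw)]:
  assumes [measurable]: "f \<in> borel_measurable M" "g \<in> borel_measurable M"
  shows "(\<lambda>x. cutoff (f x) (g x)) \<in> borel_measurable M"
    and "(\<lambda>x. cutoff_dt (f x) (g x)) \<in> borel_measurable M"
    and "(\<lambda>x. cutoff_dp (f x) (g x)) \<in> borel_measurable M"
  unfolding cutoff_def cutoff_dt_def cutoff_dp_def by measurable

section \<open>The fractional energy\<close>

text \<open>A countable cover by Borel sets of finite measure keeps its measures under completion.
  Tonelli and almost-everywhere arguments on \<open>lebesgue \<Otimes>\<^sub>M lebesgue\<close>, the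
  measure of the nonlocal term, rest on this.\<close>

lemma sigma_finite_lebesgue: "sigma_finite_measure (lebesgue :: 'a::euclidean_space measure)"
proof -
  obtain A :: "nat \<Rightarrow> 'a set" where A: "range A \<subseteq> sets lborel" "(\<Union>i. A i) = space lborel"
    "\<And>i. emeasure lborel (A i) \<noteq> \<infinity>"
    using lborel.sigma_finite by metis
  show ?thesis
  proof
    show "\<exists>C. countable C \<and> C \<subseteq> sets lebesgue \<and> \<Union>C = space (lebesgue :: 'a measure) \<and> (\<forall>a\<in>C. emeasure lebesgue a \<noteq> \<infinity>)"
      using A by (intro exI[of _ "range A"] conjI) (auto simp: emeasure_completion)
  qed
qed

interpretation lebesgue: sigma_finite_measure lebesgue
  by (rule sigma_finite_lebesgue)

interpretation lebesgue_pair: pair_sigma_finite lebesgue lebesgue ..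

lemma nn_integral_lborel_translate:
  fixes f :: "'a::euclidean_space \<Rightarrow> ennreal"
  assumes [measurable]: "f \<in> borel_measurable borel"
  shows "(\<integral>\<^sup>+ x. f (c + x) \<partial>lborel) = (\<integral>\<^sup>+ x. f x \<partial>lborel)"
proof -
  have "(\<integral>\<^sup>+ x. f x \<partial>lborel) = (\<integral>\<^sup>+ x. f x \<partial>distr lborel borel ((+) c))"
    by (simp add: lborel_distr_plus)
  also have "\<dots> = (\<integral>\<^sup>+ x. f (c + x) \<partial>lborel)"
    by (subst nn_integral_distr) auto
  finally show ?thesis by simp
qed

section \<open>Integrability of min(1, |z|^2) against the fractional kernel\<close>

lemma exists_power2_shell_ge_1:
  fixes x :: real
  assumes "1 \<le> x" shows "\<exists>k. 2 ^ k \<le> x \<and> x < 2 * 2 ^ k"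
proof -
  obtain n where "x < 2 ^ n" using real_arch_pow[of 2 x] by auto
  then have ex: "\<exists>k. x < 2 * 2 ^ k"
    using assms by (intro exI[of _ n]) simp
  define k where "k = (LEAST k. x < 2 * 2 ^ k)"
  have "x < 2 * 2 ^ k" unfolding k_def using ex by (rule LeastI_ex)
  moreover have "2 ^ k \<le> x"
  proof (cases k)
    case (Suc j)
    then have "\<not> x < 2 * 2 ^ j" using not_less_Least[of j "\<lambda>k. x < 2 * 2 ^ k"] unfolding k_def by simp
    then show ?thesis using Suc by simp
  qed (use assms in simp)
  ultimately show ?thesis by blast
qed

text \<open>With exponent \<open>Suc k\<close> the first shell is [1/2, 1), so these shells continue
  downwards those starting at [1, 2).\<close>

lemma exists_power2_shell_less_1:
  fixes x :: real
  assumes "0 < x" "x < 1" shows "\<exists>k. (1/2) ^ Suc k \<le> x \<and> x < 2 * (1/2) ^ Suc k"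
proof -
  obtain j where "(1/2) ^ j < x" using real_arch_pow_inv[of x "1/2"] assms by auto
  then have ex: "\<exists>k. (1/2) ^ Suc k \<le> x"
    by (intro exI[of _ j]) (simp, smt (verit) assms)
  define k where "k = (LEAST k. (1/2) ^ Suc k \<le> x)"
  have "(1/2) ^ Suc k \<le> x" unfolding k_def using ex by (rule LeastI_ex)
  moreover have "x < 2 * (1/2) ^ Suc k"
  proof (cases k)
    case (Suc j)
    then have "\<not> (1/2) ^ Suc j \<le> x" using not_less_Least[of j "\<lambda>k. (1/2) ^ Suc k \<le> x"] unfolding k_def by simp
    then show ?thesis using Suc by simp
  qed (use assms in simp)
  ultimately show ?thesis by blast
qed

text \<open>On the shell 1 / |z|^n is at most 1 / r^n, and the enclosing ball has volume (2 r)^n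
  times that of the unit ball. The radius cancels: all dyadic shells obey the same bound.\<close>

lemma nn_integral_shell_le:
  fixes r m :: real
  assumes "0 < r" "0 \<le> m"
  shows "(\<integral>\<^sup>+ z. ennreal (m / norm z ^ DIM('a)) * indicator {z. r \<le> norm z \<and> norm z < 2 * r} z
    \<partial>(lborel :: 'a::euclidean_space measure)) \<le> ennreal (m * (2 ^ DIM('a) * measure lborel (ball (0::'a) 1)))"
proof -
  let ?V = "measure lborel (ball (0::'a) 1)"
  have "(\<integral>\<^sup>+ z. ennreal (m / norm z ^ DIM('a)) * indicator {z. r \<le> norm z \<and> norm z < 2 * r} z
      \<partial>(lborel :: 'a measure))
      \<le> (\<integral>\<^sup>+ z. ennreal (m / r ^ DIM('a)) * indicator (ball 0 (2 * r)) z \<partial>(lborel :: 'a measure))"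
    using assms
    by (intro nn_integral_mono)
      (auto simp: indicator_def intro!: ennreal_leI divide_left_mono power_mono mult_pos_pos zero_less_power)
  also have "\<dots> = ennreal (m / r ^ DIM('a)) * emeasure lborel (ball (0::'a) (2 * r))"
    by (rule nn_integral_cmult_indicator) simp
  also have "emeasure lborel (ball (0::'a) (2 * r)) = ennreal (measure lborel (ball (0::'a) (2 * r)))"
    using emeasure_lborel_ball_finite[of "0::'a" "2 * r"] by (subst emeasure_eq_ennreal_measure) auto
  also have "ennreal (m / r ^ DIM('a)) * \<dots> = ennreal (m / r ^ DIM('a) * measure lborel (ball (0::'a) (2 * r)))"
    using assms by (simp add: ennreal_mult'' flip: times_divide_eq_left)
  also have "m / r ^ DIM('a) * measure lborel (ball (0::'a) (2 * r)) = m * (2 ^ DIM('a) * ?V)"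
    using assms content_ball_conv_unit_ball[of "2 * r" "0::'a"] by (simp add: power_mult_distrib)
  finally show ?thesis .
qed

text \<open>The scale-invariant factor 1 / |z|^n is isolated, which leaves a pure power of |z| to
  give geometric decay from shell to shell.\<close>

lemma levy_kernel_split:
  fixes z :: "'a::euclidean_space"
  assumes "z \<noteq> 0"
  shows "c / norm z powr (real DIM('a) + 2 * s) = c * norm z powr (- 2 * s) / norm z ^ DIM('a)"
  using assms by (simp add: powr_add powr_minus powr_realpow divide_simps)

text \<open>Dyadic shells replace polar coordinates.\<close>

lemma levy_kernel_integrable:
  fixes s :: real
  assumes s: "0 < s" "s < 1"
  shows "(\<integral>\<^sup>+ z. ennreal (min 1 ((norm z)\<^sup>2) / norm z powr (real DIM('a) + 2 * s))
    \<partial>(lborel :: 'a::euclidean_space measure)) < \<infinity>"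
proof -
  define V where "V = 2 ^ DIM('a) * measure lborel (ball (0::'a) 1)"
  have V: "0 \<le> V" by (simp add: V_def)
  \<comment> \<open>Ratios of the two geometric series: |z|^(2 - 2s) shrinks by \<open>p\<close>
    from one shell to the next towards the origin, |z|^(-2s) by \<open>q\<close> towards infinity.
    Here s < 1 makes \<open>p\<close> less than 1, and s > 0 makes \<open>q\<close> less than
    1.\<close>
  define p q where "p = (1/2 :: real) powr (2 - 2 * s)" and "q = (2::real) powr (- 2 * s)"
  have p: "0 \<le> p" "p < 1" using s by (auto simp: p_def powr01_less_one)
  have q: "0 \<le> q" "q < 1" using s by (auto simp: q_def powr_less_one)
  define S where "S r = {z::'a. r \<le> norm z \<and> norm z < 2 * r}" for r :: real
  have [measurable]: "S r \<in> sets borel" for r unfolding S_def by measurable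
  define P Q where "P k z = ennreal (4 * p ^ k / norm z ^ DIM('a)) * indicator (S ((1/2) ^ Suc k)) z"
    and "Q k z = ennreal (q ^ k / norm z ^ DIM('a)) * indicator (S (2 ^ k)) z" for k :: nat and z :: 'a
  have [measurable]: "P k \<in> borel_measurable borel" "Q k \<in> borel_measurable borel" for k
    unfolding P_def Q_def by measurable
  have pt: "ennreal (min 1 ((norm z)\<^sup>2) / norm z powr (real DIM('a) + 2 * s)) \<le> (\<Sum>k. P k z) + (\<Sum>k. Q k z)" for z
  proof -
    consider "z = 0" | "z \<noteq> 0" "norm z < 1" | "1 \<le> norm z" by fastforce
    then show ?thesis
    proof cases
      case 1 then show ?thesis by simp
    next
      case 2
      then obtain k where k: "(1/2) ^ Suc k \<le> norm z" "norm z < 2 * (1/2) ^ Suc k"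
        using exists_power2_shell_less_1[of "norm z"] by auto
      have "(norm z)\<^sup>2 * norm z powr (- 2 * s) = norm z powr (2 - 2 * s)"
        using 2 powr_add[of "norm z" 2 "- 2 * s"] by simp
      also have "\<dots> \<le> ((1/2) ^ k) powr (2 - 2 * s)"
        using k s by (intro powr_mono2) auto
      also have "\<dots> = p ^ k"
        by (simp add: p_def powr_power powr_powr ac_simps flip: powr_realpow)
      also have "\<dots> \<le> 4 * p ^ k" using p by simp
      finally have *: "(norm z)\<^sup>2 * norm z powr (- 2 * s) \<le> 4 * p ^ k" .
      have "min 1 ((norm z)\<^sup>2) = (norm z)\<^sup>2" using 2 by (simp add: power_le_one)
      then have "ennreal (min 1 ((norm z)\<^sup>2) / norm z powr (real DIM('a) + 2 * s)) \<le> P k z"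
        using * k 2 by (auto simp: P_def S_def levy_kernel_split intro!: ennreal_leI divide_right_mono)
      also have "\<dots> \<le> (\<Sum>k. P k z)"
        using sum_le_suminf[of "\<lambda>k. P k z" "{k}"] by simp
      finally show ?thesis by (simp add: add_increasing2)
    next
      case 3
      then obtain k where k: "2 ^ k \<le> norm z" "norm z < 2 * 2 ^ k"
        using exists_power2_shell_ge_1 by auto
      have z: "z \<noteq> 0" using 3 by auto
      have "norm z powr (- 2 * s) \<le> (2 ^ k) powr (- 2 * s)"
        using k s by (intro powr_mono2') auto
      also have "\<dots> = q ^ k"
        by (simp add: q_def powr_power powr_powr ac_simps flip: powr_realpow)
      finally have *: "norm z powr (- 2 * s) \<le> q ^ k" .
      have "min 1 ((norm z)\<^sup>2) = 1" using 3 by (simp add: one_le_power)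
      then have "ennreal (min 1 ((norm z)\<^sup>2) / norm z powr (real DIM('a) + 2 * s)) \<le> Q k z"
        using * k z by (auto simp: Q_def S_def levy_kernel_split intro!: ennreal_leI divide_right_mono)
      also have "\<dots> \<le> (\<Sum>k. Q k z)"
        using sum_le_suminf[of "\<lambda>k. Q k z" "{k}"] by simp
      finally show ?thesis by (simp add: add_increasing)
    qed
  qed
  have "(\<integral>\<^sup>+ z. ennreal (min 1 ((norm z)\<^sup>2) / norm z powr (real DIM('a) + 2 * s)) \<partial>(lborel :: 'a measure))
      \<le> (\<integral>\<^sup>+ z. (\<Sum>k. P k z) + (\<Sum>k. Q k z) \<partial>lborel)"
    by (intro nn_integral_mono pt)
  also have "\<dots> = (\<Sum>k. \<integral>\<^sup>+ z. P k z \<partial>lborel) + (\<Sum>k. \<integral>\<^sup>+ z. Q k z \<partial>lborel)"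
    by (simp add: nn_integral_add nn_integral_suminf)
  also have "\<dots> \<le> (\<Sum>k. ennreal (4 * p ^ k * V)) + (\<Sum>k. ennreal (q ^ k * V))"
    unfolding P_def Q_def S_def V_def using p q
    by (intro add_mono suminf_le nn_integral_shell_le summableI) auto
  also have "\<dots> < \<infinity>"
  proof -
    have "summable (\<lambda>k. 4 * p ^ k * V)" "summable (\<lambda>k. q ^ k * V)"
      using p q by (auto intro!: summable_mult summable_mult2 summable_geometric)
    then show ?thesis
      using p q V by (simp add: suminf_ennreal2 ennreal_add_eq_top less_top[symmetric])
  qed
  finally show ?thesis .
qed

section \<open>Translation estimates: the fractional energy is controlled by the H^1 norm\<close>

lemma continuous_on_grad:
  assumes "smooth_on UNIV \<phi>" shows "continuous_on UNIV (grad \<phi>)"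
  unfolding grad_def[abs_def]
  by (intro continuous_intros smooth_on_continuous smooth_on_frechet_derivative assms)

lemma frechet_derivative_eq_grad:
  assumes "smooth_on UNIV \<phi>"
  shows "frechet_derivative \<phi> (at x) v = grad \<phi> x \<bullet> v"
proof -
  have l: "linear (frechet_derivative \<phi> (at x))"
    using smooth_on_has_derivative[OF assms] has_derivative_linear by blast
  have "frechet_derivative \<phi> (at x) v = frechet_derivative \<phi> (at x) (\<Sum>i\<in>Basis. (v \<bullet> i) *\<^sub>R i)"
    by (simp add: euclidean_representation)
  also have "\<dots> = grad \<phi> x \<bullet> v"
    by (simp add: grad_def linear_sum[OF l] linear_cmul[OF l] inner_sum_left inner_commute[of v] mult.commute)
  finally show ?thesis .
qed

lemma grad_inner_Basis: "i \<in> Basis \<Longrightarrow> grad \<phi> x \<bullet> i = frechet_derivative \<phi> (at x) i"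
  by (simp add: grad_def)

text \<open>The increment is the mean of the directional derivative along the segment, and the
  square of a mean is at most the mean of the square. Cauchy-Schwarz in space then replaces the
  directional derivative by the gradient.\<close>

lemma diff_square_le_integral:
  assumes "smooth_on UNIV \<phi>"
  shows "ennreal ((\<phi> (x + h) - \<phi> x)\<^sup>2)
    \<le> (\<integral>\<^sup>+ t. ennreal ((norm h)\<^sup>2 * (norm (grad \<phi> (x + t *\<^sub>R h)))\<^sup>2) * indicator {0..1} t \<partial>lborel)"
proof -
  define p where "p t = frechet_derivative \<phi> (at (x + t *\<^sub>R h)) h" for t :: real
  have "continuous_on {0..1} p"
    unfolding p_def
    by (rule continuous_on_compose2[OF smooth_on_continuous[OF smooth_on_frechet_derivative[OF assms]]])
      (auto intro!: continuous_intros)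
  then have p2: "(\<lambda>t. (p t)\<^sup>2) integrable_on {0..1}"
    by (intro integrable_continuous_interval continuous_intros)
  define c where "c = \<phi> (x + h) - \<phi> x"
  have "(p has_integral (\<phi> (x + 1 *\<^sub>R h) - \<phi> (x + 0 *\<^sub>R h))) {0..1}"
  proof (rule fundamental_theorem_of_calculus)
    fix t :: real
    have "((\<lambda>t. \<phi> (x + t *\<^sub>R h)) has_derivative (\<lambda>u. frechet_derivative \<phi> (at (x + t *\<^sub>R h)) (u *\<^sub>R h))) (at t)"
      by (rule has_derivative_compose[OF _ smooth_on_has_derivative[OF assms]])
        (auto intro!: derivative_eq_intros)
    moreover have "linear (frechet_derivative \<phi> (at (x + t *\<^sub>R h)))"
      using smooth_on_has_derivative[OF assms] has_derivative_linear by blast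
    ultimately have "((\<lambda>t. \<phi> (x + t *\<^sub>R h)) has_vector_derivative p t) (at t)"
      by (simp add: has_vector_derivative_def p_def linear_cmul)
    then show "((\<lambda>t. \<phi> (x + t *\<^sub>R h)) has_vector_derivative p t) (at t within {0..1})"
      by (rule has_vector_derivative_at_within)
  qed simp
  then have pc: "(p has_integral c) {0..1}" by (simp add: c_def)
  \<comment> \<open>The variance identity: the integral of (p - c)^2 equals that of p^2 minus c^2,
    and its nonnegativity is the Jensen inequality needed here.\<close>
  have "((\<lambda>t. (p t)\<^sup>2 - 2 * c * p t + c\<^sup>2) has_integral (integral {0..1} (\<lambda>t. (p t)\<^sup>2) - 2 * c * c + c\<^sup>2)) {0..1}"
    using has_integral_const_real[of "c\<^sup>2" 0 1]
    by (intro has_integral_add has_integral_diff has_integral_mult_right integrable_integral p2 pc) auto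
  moreover have "(\<lambda>t. (p t)\<^sup>2 - 2 * c * p t + c\<^sup>2) = (\<lambda>t. (p t - c)\<^sup>2)"
    by (simp add: power2_diff algebra_simps)
  ultimately have "((\<lambda>t. (p t - c)\<^sup>2) has_integral (integral {0..1} (\<lambda>t. (p t)\<^sup>2) - 2 * c * c + c\<^sup>2)) {0..1}"
    by simp
  from has_integral_nonneg[OF this] have "0 \<le> integral {0..1} (\<lambda>t. (p t)\<^sup>2) - 2 * c * c + c\<^sup>2"
    by simp
  then have "ennreal (c\<^sup>2) \<le> ennreal (integral {0..1} (\<lambda>t. (p t)\<^sup>2))"
    by (intro ennreal_leI) (simp add: power2_eq_square)
  also have "\<dots> = (\<integral>\<^sup>+ t. ennreal ((p t)\<^sup>2) * indicator {0..1} t \<partial>lborel)"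
    by (rule nn_integral_has_integral_lebesgue'[symmetric]) (auto intro: integrable_integral p2)
  also have "\<dots> \<le> (\<integral>\<^sup>+ t. ennreal ((norm h)\<^sup>2 * (norm (grad \<phi> (x + t *\<^sub>R h)))\<^sup>2) * indicator {0..1} t \<partial>lborel)"
  proof (intro nn_integral_mono mult_right_mono ennreal_leI)
    fix t :: real
    have "\<bar>p t\<bar> \<le> norm h * norm (grad \<phi> (x + t *\<^sub>R h))"
      unfolding p_def frechet_derivative_eq_grad[OF assms]
      using Cauchy_Schwarz_ineq2[of "grad \<phi> (x + t *\<^sub>R h)" h] by (simp add: mult.commute)
    then have "\<bar>p t\<bar>\<^sup>2 \<le> (norm h * norm (grad \<phi> (x + t *\<^sub>R h)))\<^sup>2"
      by (intro power_mono) auto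
    then show "(p t)\<^sup>2 \<le> (norm h)\<^sup>2 * (norm (grad \<phi> (x + t *\<^sub>R h)))\<^sup>2"
      by (simp add: power_mult_distrib)
  qed simp
  finally show ?thesis by (simp add: c_def)
qed

text \<open>The segment estimate is integrated over \<open>x\<close>; after Tonelli, translation
  invariance makes the inner integral independent of the position \<open>t\<close> on the
  segment.\<close>

lemma nn_integral_translate_diff_le_grad:
  fixes \<phi> :: "'a::euclidean_space \<Rightarrow> real"
  assumes "smooth_on UNIV \<phi>"
  shows "(\<integral>\<^sup>+ x. ennreal ((\<phi> (x + h) - \<phi> x)\<^sup>2) \<partial>lborel)
    \<le> ennreal ((norm h)\<^sup>2) * (\<integral>\<^sup>+ x. ennreal ((norm (grad \<phi> x))\<^sup>2) \<partial>lborel)"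
proof -
  have [measurable]: "grad \<phi> \<in> borel_measurable borel"
    by (intro borel_measurable_continuous_onI continuous_on_grad assms)
  have "(\<integral>\<^sup>+ x. ennreal ((\<phi> (x + h) - \<phi> x)\<^sup>2) \<partial>lborel)
    \<le> (\<integral>\<^sup>+ x. (\<integral>\<^sup>+ t. ennreal ((norm h)\<^sup>2 * (norm (grad \<phi> (x + t *\<^sub>R h)))\<^sup>2) * indicator {0..1} t \<partial>lborel) \<partial>lborel)"
    by (intro nn_integral_mono diff_square_le_integral assms)
  also have "\<dots> = (\<integral>\<^sup>+ t. (\<integral>\<^sup>+ x. ennreal ((norm h)\<^sup>2 * (norm (grad \<phi> (x + t *\<^sub>R h)))\<^sup>2) * indicator {0..1::real} t \<partial>lborel) \<partial>lborel)"
    by (rule lborel_pair.Fubini') measurable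
  also have "\<dots> = (\<integral>\<^sup>+ t. ennreal ((norm h)\<^sup>2) * (\<integral>\<^sup>+ x. ennreal ((norm (grad \<phi> x))\<^sup>2) \<partial>lborel) * indicator {0..1::real} t \<partial>lborel)"
  proof (intro nn_integral_cong)
    fix t :: real
    have "(\<integral>\<^sup>+ x. ennreal ((norm h)\<^sup>2 * (norm (grad \<phi> (x + t *\<^sub>R h)))\<^sup>2) * indicator {0..1::real} t \<partial>lborel)
      = ennreal ((norm h)\<^sup>2) * (\<integral>\<^sup>+ x. ennreal ((norm (grad \<phi> (t *\<^sub>R h + x)))\<^sup>2) \<partial>lborel) * indicator {0..1::real} t"
      by (simp add: ennreal_mult nn_integral_multc nn_integral_cmult add.commute)
    also have "(\<integral>\<^sup>+ x. ennreal ((norm (grad \<phi> (t *\<^sub>R h + x)))\<^sup>2) \<partial>lborel) = (\<integral>\<^sup>+ x. ennreal ((norm (grad \<phi> x))\<^sup>2) \<partial>lborel)"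
      by (rule nn_integral_lborel_translate) measurable
    finally show "(\<integral>\<^sup>+ x. ennreal ((norm h)\<^sup>2 * (norm (grad \<phi> (x + t *\<^sub>R h)))\<^sup>2) * indicator {0..1::real} t \<partial>lborel)
      = ennreal ((norm h)\<^sup>2) * (\<integral>\<^sup>+ x. ennreal ((norm (grad \<phi> x))\<^sup>2) \<partial>lborel) * indicator {0..1::real} t" .
  qed
  also have "\<dots> = ennreal ((norm h)\<^sup>2) * (\<integral>\<^sup>+ x. ennreal ((norm (grad \<phi> x))\<^sup>2) \<partial>lborel)"
    by (subst nn_integral_cmult_indicator) auto
  finally show ?thesis .
qed

text \<open>From (a - b)^2 <= 2 a^2 + 2 b^2 and translation invariance. It serves for large
  \<open>h\<close>, where the gradient estimate grows like |h|^2.\<close>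

lemma nn_integral_translate_diff_le:
  fixes \<phi> :: "'a::euclidean_space \<Rightarrow> real"
  assumes [measurable]: "\<phi> \<in> borel_measurable borel"
  shows "(\<integral>\<^sup>+ x. ennreal ((\<phi> (x + h) - \<phi> x)\<^sup>2) \<partial>lborel) \<le> 4 * (\<integral>\<^sup>+ x. ennreal ((\<phi> x)\<^sup>2) \<partial>lborel)"
proof -
  have "(\<integral>\<^sup>+ x. ennreal ((\<phi> (x + h) - \<phi> x)\<^sup>2) \<partial>lborel)
      \<le> (\<integral>\<^sup>+ x. 2 * ennreal ((\<phi> (h + x))\<^sup>2) + 2 * ennreal ((\<phi> x)\<^sup>2) \<partial>lborel)"
  proof (intro nn_integral_mono)
    fix x
    have "(\<phi> (x + h) - \<phi> x)\<^sup>2 \<le> 2 * (\<phi> (h + x))\<^sup>2 + 2 * (\<phi> x)\<^sup>2"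
    proof -
      have "2 * (\<phi> (h + x))\<^sup>2 + 2 * (\<phi> x)\<^sup>2 - (\<phi> (x + h) - \<phi> x)\<^sup>2 = (\<phi> (h + x) + \<phi> x)\<^sup>2"
        by (simp add: power2_eq_square algebra_simps)
      then show ?thesis using zero_le_power2[of "\<phi> (h + x) + \<phi> x"] by linarith
    qed
    then have "ennreal ((\<phi> (x + h) - \<phi> x)\<^sup>2) \<le> ennreal (2 * (\<phi> (h + x))\<^sup>2 + 2 * (\<phi> x)\<^sup>2)"
      by (rule ennreal_leI)
    then show "ennreal ((\<phi> (x + h) - \<phi> x)\<^sup>2) \<le> 2 * ennreal ((\<phi> (h + x))\<^sup>2) + 2 * ennreal ((\<phi> x)\<^sup>2)"
      by (simp add: ennreal_mult)
  qed
  also have "\<dots> = 2 * (\<integral>\<^sup>+ x. ennreal ((\<phi> (h + x))\<^sup>2) \<partial>lborel) + 2 * (\<integral>\<^sup>+ x. ennreal ((\<phi> x)\<^sup>2) \<partial>lborel)"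
    by (simp add: nn_integral_add nn_integral_cmult)
  also have "(\<integral>\<^sup>+ x. ennreal ((\<phi> (h + x))\<^sup>2) \<partial>lborel) = (\<integral>\<^sup>+ x. ennreal ((\<phi> x)\<^sup>2) \<partial>lborel)"
    by (rule nn_integral_lborel_translate) measurable
  also have "2 * I + 2 * I = 4 * I" for I :: ennreal
    using distrib_right[of 2 2 I] by simp
  finally show ?thesis .
qed

text \<open>The square root of the kernel, so that the nonlocal form becomes an \<open>L\<^sup>2\<close> pairing of quotients.\<close>

definition frac_quot :: "real \<Rightarrow> ('a::euclidean_space \<Rightarrow> real) \<Rightarrow> 'a \<times> 'a \<Rightarrow> real" where
  "frac_quot s u z = (u (fst z) - u (snd z)) / norm (fst z - snd z) powr ((real DIM('a) + 2 * s) / 2)"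

lemma frac_quot_mult:
  fixes u :: "'a::euclidean_space \<Rightarrow> real"
  shows "frac_quot s u z * frac_quot s v z
    = (u (fst z) - u (snd z)) * (v (fst z) - v (snd z)) / norm (fst z - snd z) powr (real DIM('a) + 2 * s)"
  by (simp add: frac_quot_def flip: powr_add)

lemma measurable_id_lebesgue [measurable]: "(\<lambda>x. x) \<in> borel_measurable lebesgue"
  by (simp add: borel_measurable_continuous_onI measurable_completion)

lemma measurable_fst_snd_lebesgue [measurable]:
  "fst \<in> borel_measurable (lebesgue \<Otimes>\<^sub>M M)" "snd \<in> borel_measurable (M \<Otimes>\<^sub>M lebesgue)"
  using measurable_compose[OF measurable_fst measurable_id_lebesgue]
    measurable_compose[OF measurable_snd measurable_id_lebesgue] by simp_all

lemma borel_measurable_frac_quot [measurable]: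
  assumes [measurable]: "u \<in> borel_measurable lebesgue"
  shows "frac_quot s u \<in> borel_measurable (lebesgue \<Otimes>\<^sub>M lebesgue)"
  unfolding frac_quot_def[abs_def] by measurable

text \<open>In the variables x and h = y - x the energy is a kernel-weighted integral of squared
  translation differences. Those are of order min(1, |h|^2), which is integrable against the
  kernel.\<close>

lemma frac_energy_le:
  fixes \<phi> :: "'a::euclidean_space \<Rightarrow> real"
  assumes \<phi>: "smooth_on UNIV \<phi>"
  shows "(\<integral>\<^sup>+ z. ennreal ((frac_quot s \<phi> z)\<^sup>2) \<partial>(lebesgue \<Otimes>\<^sub>M lebesgue))
    \<le> 4 * (\<integral>\<^sup>+ z. ennreal (min 1 ((norm z)\<^sup>2) / norm z powr (real DIM('a) + 2 * s)) \<partial>(lborel :: 'a measure))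
      * ((\<integral>\<^sup>+ x. ennreal ((\<phi> x)\<^sup>2) \<partial>lebesgue) + (\<integral>\<^sup>+ x. ennreal ((norm (grad \<phi> x))\<^sup>2) \<partial>lebesgue))"
proof -
  define K where "K z = min 1 ((norm z)\<^sup>2) / norm z powr (real DIM('a) + 2 * s)" for z :: 'a
  have [measurable]: "K \<in> borel_measurable borel" unfolding K_def by measurable
  have [measurable]: "\<phi> \<in> borel_measurable borel"
    by (intro borel_measurable_continuous_onI smooth_on_continuous \<phi>)
  then have [measurable]: "\<phi> \<in> borel_measurable lebesgue" by (simp add: measurable_completion)
  define k where "k z = 1 / norm z powr (real DIM('a) + 2 * s)" for z :: 'a
  have k0: "0 \<le> k z" for z by (simp add: k_def)
  have [measurable]: "k \<in> borel_measurable borel" unfolding k_def by measurable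
  have kneg: "k (- z) = k z" for z by (simp add: k_def)
  define E where "E = (\<integral>\<^sup>+ x. ennreal ((\<phi> x)\<^sup>2) \<partial>lborel) + (\<integral>\<^sup>+ x. ennreal ((norm (grad \<phi> x))\<^sup>2) \<partial>lborel)"
  \<comment> \<open>Short translations use the gradient, long ones the L^2 norm; the common factor
    \<open>4 * E\<close> dominates both.\<close>
  have bound: "(\<integral>\<^sup>+ x. ennreal ((\<phi> (x + h) - \<phi> x)\<^sup>2) \<partial>lborel) \<le> ennreal (min 1 ((norm h)\<^sup>2)) * (4 * E)" for h
  proof (cases "norm h \<le> 1")
    case True
    then have m: "min 1 ((norm h)\<^sup>2) = (norm h)\<^sup>2" by (simp add: power_le_one)
    have "(\<integral>\<^sup>+ x. ennreal ((norm (grad \<phi> x))\<^sup>2) \<partial>lborel) \<le> 4 * E"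
    proof -
      have "(\<integral>\<^sup>+ x. ennreal ((norm (grad \<phi> x))\<^sup>2) \<partial>lborel) \<le> 1 * E"
        by (simp add: E_def add_increasing)
      also have "\<dots> \<le> 4 * E" by (intro mult_right_mono) auto
      finally show ?thesis .
    qed
    then show ?thesis
      unfolding m
      by (intro order_trans[OF nn_integral_translate_diff_le_grad[OF \<phi>, of h]] mult_left_mono) auto
  next
    case False
    then have m: "min 1 ((norm h)\<^sup>2) = 1" by (simp add: one_le_power)
    have "(\<integral>\<^sup>+ x. ennreal ((\<phi> (x + h) - \<phi> x)\<^sup>2) \<partial>lborel) \<le> 4 * (\<integral>\<^sup>+ x. ennreal ((\<phi> x)\<^sup>2) \<partial>lborel)"
      by (rule nn_integral_translate_diff_le) measurable
    also have "\<dots> \<le> 4 * E" by (intro mult_left_mono) (auto simp: E_def add_increasing2)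
    finally show ?thesis by (simp add: m)
  qed
  have "(\<integral>\<^sup>+ z. ennreal ((frac_quot s \<phi> z)\<^sup>2) \<partial>(lebesgue \<Otimes>\<^sub>M lebesgue))
    = (\<integral>\<^sup>+ z. ennreal ((\<phi> (fst z) - \<phi> (snd z))\<^sup>2 * k (fst z - snd z)) \<partial>(lebesgue \<Otimes>\<^sub>M lebesgue))"
    by (simp add: power2_eq_square frac_quot_mult k_def)
  also have "\<dots> = (\<integral>\<^sup>+ x. (\<integral>\<^sup>+ y. ennreal ((\<phi> x - \<phi> y)\<^sup>2 * k (x - y)) \<partial>lebesgue) \<partial>lebesgue)"
    by (subst lebesgue.nn_integral_fst[symmetric]) (auto, measurable)
  \<comment> \<open>Passing from the completion to \<open>lborel\<close> makes its translation
    invariance and \<open>lborel_pair\<close> available.\<close>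
  also have "\<dots> = (\<integral>\<^sup>+ x. (\<integral>\<^sup>+ y. ennreal ((\<phi> x - \<phi> y)\<^sup>2 * k (x - y)) \<partial>lborel) \<partial>lborel)"
    by (simp add: nn_integral_completion)
  \<comment> \<open>Substitution y = x + h at fixed x; the sign of h is harmless because the kernel
    is even and the difference is squared.\<close>
  also have "\<dots> = (\<integral>\<^sup>+ x. (\<integral>\<^sup>+ h. ennreal ((\<phi> (x + h) - \<phi> x)\<^sup>2 * k h) \<partial>lborel) \<partial>lborel)"
  proof (rule nn_integral_cong)
    fix x
    have "(\<integral>\<^sup>+ y. ennreal ((\<phi> x - \<phi> y)\<^sup>2 * k (x - y)) \<partial>lborel)
      = (\<integral>\<^sup>+ h. ennreal ((\<phi> x - \<phi> (x + h))\<^sup>2 * k (x - (x + h))) \<partial>lborel)"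
      by (rule nn_integral_lborel_translate[symmetric]) measurable
    then show "(\<integral>\<^sup>+ y. ennreal ((\<phi> x - \<phi> y)\<^sup>2 * k (x - y)) \<partial>lborel)
      = (\<integral>\<^sup>+ h. ennreal ((\<phi> (x + h) - \<phi> x)\<^sup>2 * k h) \<partial>lborel)"
      by (simp add: kneg power2_commute)
  qed
  also have "\<dots> = (\<integral>\<^sup>+ h. (\<integral>\<^sup>+ x. ennreal ((\<phi> (x + h) - \<phi> x)\<^sup>2 * k h) \<partial>lborel) \<partial>lborel)"
    by (rule lborel_pair.Fubini') measurable
  also have "\<dots> = (\<integral>\<^sup>+ h. (\<integral>\<^sup>+ x. ennreal ((\<phi> (x + h) - \<phi> x)\<^sup>2) \<partial>lborel) * ennreal (k h) \<partial>lborel)"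
    by (simp add: ennreal_mult k0 nn_integral_multc)
  also have "\<dots> \<le> (\<integral>\<^sup>+ h. ennreal (min 1 ((norm h)\<^sup>2)) * (4 * E) * ennreal (k h) \<partial>lborel)"
    by (intro nn_integral_mono mult_right_mono bound) auto
  also have "\<dots> = (\<integral>\<^sup>+ h. ennreal (K h) * (4 * E) \<partial>lborel)"
  proof (rule nn_integral_cong)
    fix h :: 'a
    have "ennreal (K h) = ennreal (min 1 ((norm h)\<^sup>2)) * ennreal (k h)"
      by (simp add: K_def k_def flip: ennreal_mult')
    then show "ennreal (min 1 ((norm h)\<^sup>2)) * (4 * E) * ennreal (k h) = ennreal (K h) * (4 * E)"
      by (simp add: mult_ac)
  qed
  also have "\<dots> = 4 * (\<integral>\<^sup>+ z. ennreal (K z) \<partial>lborel) * E"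
    by (subst nn_integral_multc) (auto simp: mult_ac)
  finally show ?thesis by (simp add: E_def K_def nn_integral_completion)
qed

section \<open>Passing to the limit\<close>

lemma smooth_on_cutoff:
  assumes "smooth_on UNIV f" "smooth_on UNIV g"
  shows "smooth_on UNIV (\<lambda>x. cutoff (f x) (g x))"
proof -
  have "1 + f x * f x + g x * g x \<noteq> 0" for x
    using cutoff_denominator_pos[of "f x" "g x"] by (simp add: power2_eq_square)
  then have "smooth_on UNIV (\<lambda>x. f x * (g x * g x) * inverse (1 + f x * f x + g x * g x))"
    by (intro smooth_on_algebra_intros assms)
  moreover have "(\<lambda>x. cutoff (f x) (g x)) = (\<lambda>x. f x * (g x * g x) * inverse (1 + f x * f x + g x * g x))"
    by (simp add: cutoff_def power2_eq_square divide_inverse fun_eq_iff)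
  ultimately show ?thesis by simp
qed

lemma has_derivative_cutoff:
  assumes f: "(f has_derivative f') (at x)" and g: "(g has_derivative g') (at x)"
  shows "((\<lambda>x. cutoff (f x) (g x)) has_derivative
    (\<lambda>v. cutoff_dt (f x) (g x) * f' v + cutoff_dp (f x) (g x) * g' v)) (at x)"
proof -
  have nz: "1 + (f x)\<^sup>2 + (g x)\<^sup>2 \<noteq> 0" using cutoff_denominator_pos[of "f x" "g x"] by simp
  show ?thesis
    unfolding cutoff_def
    by (rule derivative_eq_intros refl f g nz)+
      (use nz in \<open>auto simp: cutoff_dt_def cutoff_dp_def fun_eq_iff divide_simps\<close>,
        simp add: algebra_simps power2_eq_square)
qed

lemma grad_cutoff:
  assumes "smooth_on UNIV f" "smooth_on UNIV g"
  shows "grad (\<lambda>x. cutoff (f x) (g x)) x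
    = cutoff_dt (f x) (g x) *\<^sub>R grad f x + cutoff_dp (f x) (g x) *\<^sub>R grad g x"
proof -
  have "frechet_derivative (\<lambda>x. cutoff (f x) (g x)) (at x)
    = (\<lambda>v. cutoff_dt (f x) (g x) * frechet_derivative f (at x) v + cutoff_dp (f x) (g x) * frechet_derivative g (at x) v)"
    by (rule frechet_derivative_at[symmetric], rule has_derivative_cutoff)
      (intro smooth_on_has_derivative assms)+
  then show ?thesis
    by (simp add: grad_def sum.distrib scaleR_left_distrib scaleR_sum_right)
qed

lemma grad_diff:
  assumes "smooth_on UNIV f" "smooth_on UNIV g"
  shows "grad (\<lambda>x. f x - g x) x = grad f x - grad g x"
proof -
  have "frechet_derivative (\<lambda>x. f x - g x) (at x)
    = (\<lambda>v. frechet_derivative f (at x) v - frechet_derivative g (at x) v)"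
    by (rule frechet_derivative_at[symmetric], rule has_derivative_diff)
      (intro smooth_on_has_derivative assms)+
  then show ?thesis
    by (simp add: grad_def scaleR_left_diff_distrib sum_subtractf)
qed

text \<open>Because \<open>cutoff t 0 = 0\<close>, the support of \<open>g\<close> contains that of
  the composite, so the compact set stays the same while \<open>f\<close> ranges over smooth
  functions.\<close>

lemma test_fun_cutoff:
  assumes f: "smooth_on UNIV f" and g: "test_fun U g"
  shows "test_fun U (\<lambda>x. cutoff (f x) (g x))"
proof (rule test_funI)
  show "smooth_on UNIV (\<lambda>x. cutoff (f x) (g x))"
    by (intro smooth_on_cutoff f test_fun_smooth[OF g])
  show "compact (closure {x. g x \<noteq> 0})" "closure {x. g x \<noteq> 0} \<subseteq> U"
    using test_fun_compact_support[OF g] test_fun_support[OF g] by simp_all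
  fix x assume "x \<notin> closure {x. g x \<noteq> 0}"
  then have "x \<notin> {x. g x \<noteq> 0}" using closure_subset[of "{x. g x \<noteq> 0}"] by blast
  then show "cutoff (f x) (g x) = 0" by (simp add: cutoff_0)
qed (rule closed_closure)

lemma test_fun_grad_lebesgue: "test_fun U f \<Longrightarrow> grad f \<in> borel_measurable lebesgue"
  by (intro measurable_completion) (simp add: borel_measurable_continuous_onI continuous_on_grad test_fun_smooth)

lemma norm_square_eq_sum_Basis: "(norm (x::'a::euclidean_space))\<^sup>2 = (\<Sum>i\<in>Basis. (x \<bullet> i)\<^sup>2)"
  unfolding power2_norm_eq_inner by (subst euclidean_inner) (simp add: power2_eq_square)

lemma test_fun_grad_square_integrable:
  assumes "test_fun U f" shows "integrable lebesgue (\<lambda>x. (norm (grad f x))\<^sup>2)"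
  unfolding norm_square_eq_sum_Basis
  by (intro Bochner_Integration.integrable_sum)
    (simp add: grad_inner_Basis test_fun_square_integrable[OF test_fun_frechet_derivative[OF assms]])

lemma frac_quot_diff: "frac_quot s (\<lambda>x. f x - g x) z = frac_quot s f z - frac_quot s g z"
  by (simp add: frac_quot_def algebra_simps flip: diff_divide_distrib)

lemma abs_frac_quot_cutoff_le:
  "\<bar>frac_quot s (\<lambda>x. cutoff (f x) (g x)) z\<bar> \<le> \<bar>frac_quot s f z\<bar> + \<bar>frac_quot s g z\<bar>"
  unfolding frac_quot_def abs_divide
  by (simp flip: add_divide_distrib) (intro divide_right_mono cutoff_lipschitz, simp)

lemma frac_quot_tendsto:
  assumes "(\<lambda>j. f j (fst z)) \<longlonglongrightarrow> g (fst z)" "(\<lambda>j. f j (snd z)) \<longlonglongrightarrow> g (snd z)"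
  shows "(\<lambda>j. frac_quot s (f j) z) \<longlonglongrightarrow> frac_quot s g z"
  unfolding frac_quot_def divide_inverse by (intro tendsto_intros assms)

text \<open>A null set containing all exceptions provides the measurable predicate that the
  product-measure rule asks for.\<close>

lemma AE_lebesgue_pair:
  fixes P :: "'a::euclidean_space \<Rightarrow> bool"
  assumes "AE x in lebesgue. P x"
  shows "AE z in lebesgue \<Otimes>\<^sub>M lebesgue. P (fst z) \<and> P (snd z)"
proof -
  obtain N where N: "N \<in> null_sets lebesgue" "{x. \<not> P x} \<subseteq> N"
    using assms by (auto simp: eventually_ae_filter)
  have [measurable]: "N \<in> sets lebesgue" using N by auto
  have "AE x in lebesgue. x \<notin> N" using N(1) by (rule AE_not_in)
  then have "AE z in lebesgue \<Otimes>\<^sub>M lebesgue. fst z \<notin> N \<and> snd z \<notin> N"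
    by (intro lebesgue_pair.AE_pair_measure) (measurable, auto elim: eventually_mono)
  then show ?thesis by (rule eventually_mono) (use N(2) in blast)
qed

text \<open>\<open>W\<close> has the role of the gradient of \<open>w\<close>, but enters only as
  the limit of the gradients of the approximations. Everything lives on the whole space, with test
  functions supported in \<open>U\<close>, because the nonlocal form sees all of it.\<close>

locale test_fun_limit =
  fixes U :: "'a::euclidean_space set" and s :: real and \<psi> :: "nat \<Rightarrow> 'a \<Rightarrow> real"
    and w :: "'a \<Rightarrow> real" and W :: "'a \<Rightarrow> 'a"
  assumes s: "0 < s" "s < 1"
    and test: "\<And>j. test_fun U (\<psi> j)"
    and w_meas [measurable]: "w \<in> borel_measurable lebesgue"
    and W_meas [measurable]: "W \<in> borel_measurable lebesgue"
    and w_int: "integrable lebesgue (\<lambda>x. (w x)\<^sup>2)"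
    and W_int: "integrable lebesgue (\<lambda>x. (norm (W x))\<^sup>2)"
    and lim: "(\<lambda>j. (\<integral>x. (\<psi> j x - w x)\<^sup>2 \<partial>lebesgue) + (\<integral>x. (norm (grad (\<psi> j) x - W x))\<^sup>2 \<partial>lebesgue)) \<longlonglongrightarrow> 0"
    and w_AE: "AE x in lebesgue. (\<lambda>j. \<psi> j x) \<longlonglongrightarrow> w x"
    and W_AE: "AE x in lebesgue. (\<lambda>j. grad (\<psi> j) x) \<longlonglongrightarrow> W x"
begin

lemma \<psi>_meas [measurable]: "\<psi> j \<in> borel_measurable lebesgue"
  using test by (rule test_fun_lebesgue)

lemma grad_\<psi>_meas [measurable]: "grad (\<psi> j) \<in> borel_measurable lebesgue"
  using test by (rule test_fun_grad_lebesgue)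

lemma w_AE_pair: "AE z in lebesgue \<Otimes>\<^sub>M lebesgue. (\<lambda>j. \<psi> j (fst z)) \<longlonglongrightarrow> w (fst z) \<and> (\<lambda>j. \<psi> j (snd z)) \<longlonglongrightarrow> w (snd z)"
  by (rule AE_lebesgue_pair[OF w_AE])

lemma diff_int: "integrable lebesgue (\<lambda>x. (\<psi> j x - w x)\<^sup>2)"
  by (intro integrable_square_diff \<psi>_meas w_meas w_int test_fun_square_integrable[OF test])

lemma component_int:
  assumes "i \<in> Basis" shows "integrable lebesgue (\<lambda>x. (W x \<bullet> i)\<^sup>2)"
proof (rule Bochner_Integration.integrable_bound[OF W_int])
  have "(W x \<bullet> i)\<^sup>2 \<le> (norm (W x))\<^sup>2" for x
    using power_mono[OF Basis_le_norm[OF assms, of "W x"], of 2] by simp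
  then show "AE x in lebesgue. norm ((W x \<bullet> i)\<^sup>2) \<le> norm ((norm (W x))\<^sup>2)"
    by (intro always_eventually allI) simp
qed measurable

lemma grad_component_int: "i \<in> Basis \<Longrightarrow> integrable lebesgue (\<lambda>x. (grad (\<psi> j) x \<bullet> i)\<^sup>2)"
  by (simp add: grad_inner_Basis test_fun_square_integrable[OF test_fun_frechet_derivative[OF test]])

lemma grad_component_diff_int: "i \<in> Basis \<Longrightarrow> integrable lebesgue (\<lambda>x. (grad (\<psi> j) x \<bullet> i - W x \<bullet> i)\<^sup>2)"
  by (intro integrable_square_diff component_int grad_component_int) measurable

lemma grad_diff_int: "integrable lebesgue (\<lambda>x. (norm (grad (\<psi> j) x - W x))\<^sup>2)"
  unfolding norm_square_eq_sum_Basis inner_diff_left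
  by (intro Bochner_Integration.integrable_sum grad_component_diff_int)

definition err :: "nat \<Rightarrow> real" where
  "err j = (\<integral>x. (\<psi> j x - w x)\<^sup>2 \<partial>lebesgue) + (\<integral>x. (norm (grad (\<psi> j) x - W x))\<^sup>2 \<partial>lebesgue)"

lemma err_nonneg: "0 \<le> err j"
  by (simp add: err_def)

lemma err_tendsto: "err \<longlonglongrightarrow> 0"
  using lim by (simp add: err_def[abs_def])

lemma grad_component_lim:
  assumes "i \<in> Basis"
  shows "(\<lambda>j. \<integral>x. (grad (\<psi> j) x \<bullet> i - W x \<bullet> i)\<^sup>2 \<partial>lebesgue) \<longlonglongrightarrow> 0"
proof (rule Lim_null_comparison[OF _ err_tendsto])
  have "(\<integral>x. (grad (\<psi> j) x \<bullet> i - W x \<bullet> i)\<^sup>2 \<partial>lebesgue) \<le> err j" for j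
  proof -
    have "(\<integral>x. (grad (\<psi> j) x \<bullet> i - W x \<bullet> i)\<^sup>2 \<partial>lebesgue) \<le> (\<integral>x. (norm (grad (\<psi> j) x - W x))\<^sup>2 \<partial>lebesgue)"
    proof (intro integral_mono grad_component_diff_int grad_diff_int assms)
      fix x
      show "(grad (\<psi> j) x \<bullet> i - W x \<bullet> i)\<^sup>2 \<le> (norm (grad (\<psi> j) x - W x))\<^sup>2"
        using power_mono[OF Basis_le_norm[OF assms, of "grad (\<psi> j) x - W x"], of 2]
        by (simp add: inner_diff_left)
    qed
    then show ?thesis by (simp add: err_def add_increasing)
  qed
  then show "\<forall>\<^sub>F j in sequentially. norm (\<integral>x. (grad (\<psi> j) x \<bullet> i - W x \<bullet> i)\<^sup>2 \<partial>lebesgue) \<le> err j"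
    by (intro always_eventually allI) simp
qed

text \<open>A quantitative Cauchy property in H^1, in extended nonnegative form so that it can be
  fed into \<open>frac_energy_le\<close>.\<close>

lemma nn_integral_diff_\<psi>_le:
  "(\<integral>\<^sup>+ x. ennreal ((\<psi> j x - \<psi> m x)\<^sup>2) \<partial>lebesgue)
    + (\<integral>\<^sup>+ x. ennreal ((norm (grad (\<lambda>x. \<psi> j x - \<psi> m x) x))\<^sup>2) \<partial>lebesgue) \<le> ennreal (2 * err j + 2 * err m)"
proof -
  \<comment> \<open>By the parallelogram law, the right side exceeds the left by the squared norm of
    (a - c) + (b - c).\<close>
  have sq: "norm (a - b) ^ 2 \<le> 2 * norm (a - c) ^ 2 + 2 * norm (b - c) ^ 2" for a b c :: "'c::real_inner"
  proof -
    have "2 * norm (a - c) ^ 2 + 2 * norm (b - c) ^ 2 - norm (a - b) ^ 2 = norm ((a - c) + (b - c)) ^ 2"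
      by (simp add: power2_norm_eq_inner inner_diff_left inner_diff_right inner_add_left inner_add_right inner_commute)
    then show ?thesis using zero_le_power2[of "norm ((a - c) + (b - c))"] by linarith
  qed
  have "(\<integral>\<^sup>+ x. ennreal ((\<psi> j x - \<psi> m x)\<^sup>2) \<partial>lebesgue)
      \<le> (\<integral>\<^sup>+ x. ennreal (2 * (\<psi> j x - w x)\<^sup>2 + 2 * (\<psi> m x - w x)\<^sup>2) \<partial>lebesgue)"
    using sq[of "\<psi> j x" "\<psi> m x" "w x" for x] by (intro nn_integral_mono ennreal_leI) simp
  also have "\<dots> = ennreal (\<integral>x. 2 * (\<psi> j x - w x)\<^sup>2 + 2 * (\<psi> m x - w x)\<^sup>2 \<partial>lebesgue)"
    using diff_int by (intro nn_integral_eq_integral) auto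
  also have "\<dots> = ennreal (2 * (\<integral>x. (\<psi> j x - w x)\<^sup>2 \<partial>lebesgue) + 2 * (\<integral>x. (\<psi> m x - w x)\<^sup>2 \<partial>lebesgue))"
    using diff_int by simp
  finally have 1: "(\<integral>\<^sup>+ x. ennreal ((\<psi> j x - \<psi> m x)\<^sup>2) \<partial>lebesgue) \<le> \<dots>" .
  have "(\<integral>\<^sup>+ x. ennreal ((norm (grad (\<lambda>x. \<psi> j x - \<psi> m x) x))\<^sup>2) \<partial>lebesgue)
      \<le> (\<integral>\<^sup>+ x. ennreal (2 * (norm (grad (\<psi> j) x - W x))\<^sup>2 + 2 * (norm (grad (\<psi> m) x - W x))\<^sup>2) \<partial>lebesgue)"
    by (intro nn_integral_mono ennreal_leI) (simp add: grad_diff[OF test_fun_smooth[OF test] test_fun_smooth[OF test]] sq)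
  also have "\<dots> = ennreal (\<integral>x. 2 * (norm (grad (\<psi> j) x - W x))\<^sup>2 + 2 * (norm (grad (\<psi> m) x - W x))\<^sup>2 \<partial>lebesgue)"
    using grad_diff_int by (intro nn_integral_eq_integral) auto
  also have "\<dots> = ennreal (2 * (\<integral>x. (norm (grad (\<psi> j) x - W x))\<^sup>2 \<partial>lebesgue) + 2 * (\<integral>x. (norm (grad (\<psi> m) x - W x))\<^sup>2 \<partial>lebesgue))"
    using grad_diff_int by simp
  finally have 2: "(\<integral>\<^sup>+ x. ennreal ((norm (grad (\<lambda>x. \<psi> j x - \<psi> m x) x))\<^sup>2) \<partial>lebesgue) \<le> \<dots>" .
  show ?thesis
    using add_mono[OF 1 2] by (simp add: err_def algebra_simps flip: ennreal_plus)
qed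

text \<open>Since \<open>w\<close> need not be smooth, the energy bound is first applied to
  \<open>\<psi> j - \<psi> m\<close>; Fatou as m tends to infinity replaces \<open>\<psi> m\<close>
  by \<open>w\<close>. The resulting bound, a constant times \<open>err j\<close>, gives finiteness
  and convergence at once.\<close>

lemma
  shows frac_diff_int: "integrable (lebesgue \<Otimes>\<^sub>M lebesgue) (\<lambda>z. (frac_quot s (\<psi> j) z - frac_quot s w z)\<^sup>2)"
    and frac_diff_lim: "(\<lambda>j. \<integral>z. (frac_quot s (\<psi> j) z - frac_quot s w z)\<^sup>2 \<partial>(lebesgue \<Otimes>\<^sub>M lebesgue)) \<longlonglongrightarrow> 0"
proof -
  let ?P = "lebesgue \<Otimes>\<^sub>M lebesgue :: ('a \<times> 'a) measure"
  define I where "I = (\<integral>\<^sup>+ z. ennreal (min 1 ((norm z)\<^sup>2) / norm z powr (real DIM('a) + 2 * s)) \<partial>(lborel :: 'a measure))"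
  define C where "C = 4 * enn2real I"
  have "I < top" using levy_kernel_integrable[OF s, where 'a='a] by (simp add: I_def)
  then have C: "4 * I = ennreal C" "0 \<le> C" by (simp_all add: C_def ennreal_mult)
  have E: "(\<integral>\<^sup>+ z. ennreal ((frac_quot s (\<psi> j) z - frac_quot s (\<psi> m) z)\<^sup>2) \<partial>?P) \<le> ennreal (C * (2 * err j + 2 * err m))" for j m
  proof -
    have "(\<integral>\<^sup>+ z. ennreal ((frac_quot s (\<psi> j) z - frac_quot s (\<psi> m) z)\<^sup>2) \<partial>?P)
      \<le> 4 * I * ((\<integral>\<^sup>+ x. ennreal ((\<psi> j x - \<psi> m x)\<^sup>2) \<partial>lebesgue)
        + (\<integral>\<^sup>+ x. ennreal ((norm (grad (\<lambda>x. \<psi> j x - \<psi> m x) x))\<^sup>2) \<partial>lebesgue))"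
      unfolding frac_quot_diff[symmetric] I_def
      by (intro frac_energy_le smooth_on_diff test_fun_smooth[OF test])
    also have "\<dots> \<le> ennreal C * ennreal (2 * err j + 2 * err m)"
      unfolding C(1) by (intro mult_left_mono nn_integral_diff_\<psi>_le) simp
    finally show ?thesis using C(2) err_nonneg by (simp add: ennreal_mult)
  qed
  have F: "(\<integral>\<^sup>+ z. ennreal ((frac_quot s (\<psi> j) z - frac_quot s w z)\<^sup>2) \<partial>?P) \<le> ennreal (C * (2 * err j))" for j
  proof -
    have "(\<integral>\<^sup>+ z. ennreal ((frac_quot s (\<psi> j) z - frac_quot s w z)\<^sup>2) \<partial>?P)
      \<le> (\<integral>\<^sup>+ z. liminf (\<lambda>m. ennreal ((frac_quot s (\<psi> j) z - frac_quot s (\<psi> m) z)\<^sup>2)) \<partial>?P)"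
    proof (rule nn_integral_mono_AE)
      show "AE z in ?P. ennreal ((frac_quot s (\<psi> j) z - frac_quot s w z)\<^sup>2)
        \<le> liminf (\<lambda>m. ennreal ((frac_quot s (\<psi> j) z - frac_quot s (\<psi> m) z)\<^sup>2))"
        using w_AE_pair
      proof eventually_elim
        case (elim z)
        then have "(\<lambda>m. frac_quot s (\<psi> m) z) \<longlonglongrightarrow> frac_quot s w z"
          by (intro frac_quot_tendsto) auto
        then have "(\<lambda>m. ennreal ((frac_quot s (\<psi> j) z - frac_quot s (\<psi> m) z)\<^sup>2))
          \<longlonglongrightarrow> ennreal ((frac_quot s (\<psi> j) z - frac_quot s w z)\<^sup>2)"
          by (intro tendsto_ennrealI tendsto_intros)
        from lim_imp_Liminf[OF _ this] show ?case by simp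
      qed
    qed
    also have "\<dots> \<le> liminf (\<lambda>m. \<integral>\<^sup>+ z. ennreal ((frac_quot s (\<psi> j) z - frac_quot s (\<psi> m) z)\<^sup>2) \<partial>?P)"
      by (rule nn_integral_liminf) measurable
    also have "\<dots> \<le> liminf (\<lambda>m. ennreal (C * (2 * err j + 2 * err m)))"
      by (intro Liminf_mono always_eventually allI E)
    also have "\<dots> = ennreal (C * (2 * err j + 2 * 0))"
      by (intro lim_imp_Liminf tendsto_ennrealI tendsto_intros err_tendsto) simp
    finally show ?thesis by simp
  qed
  show int: "integrable ?P (\<lambda>z. (frac_quot s (\<psi> j) z - frac_quot s w z)\<^sup>2)" for j
    by (rule integrableI_nonneg) (use F[of j] in \<open>auto intro: le_less_trans\<close>)
  show "(\<lambda>j. \<integral>z. (frac_quot s (\<psi> j) z - frac_quot s w z)\<^sup>2 \<partial>?P) \<longlonglongrightarrow> 0"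
  proof (rule Lim_null_comparison)
    have "(\<integral>z. (frac_quot s (\<psi> j) z - frac_quot s w z)\<^sup>2 \<partial>?P) \<le> C * (2 * err j)" for j
    proof -
      have "ennreal (\<integral>z. (frac_quot s (\<psi> j) z - frac_quot s w z)\<^sup>2 \<partial>?P) \<le> ennreal (C * (2 * err j))"
        using F[of j] by (subst (asm) nn_integral_eq_integral[OF int]) auto
      then show ?thesis using C(2) err_nonneg[of j] by simp
    qed
    then show "\<forall>\<^sub>F j in sequentially. norm (\<integral>z. (frac_quot s (\<psi> j) z - frac_quot s w z)\<^sup>2 \<partial>?P) \<le> C * (2 * err j)"
      by (intro always_eventually allI) simp
    show "(\<lambda>j. C * (2 * err j)) \<longlonglongrightarrow> 0"
      using tendsto_mult[OF tendsto_const[of C] tendsto_mult[OF tendsto_const[of 2] err_tendsto]] by simp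
  qed
qed

lemma frac_test_int: "integrable (lebesgue \<Otimes>\<^sub>M lebesgue) (\<lambda>z. (frac_quot s (\<psi> j) z)\<^sup>2)"
proof -
  have "(\<integral>\<^sup>+ x. ennreal ((\<psi> j x)\<^sup>2) \<partial>lebesgue) < top" "(\<integral>\<^sup>+ x. ennreal ((norm (grad (\<psi> j) x))\<^sup>2) \<partial>lebesgue) < top"
    using test_fun_square_integrable[OF test] test_fun_grad_square_integrable[OF test]
    by (simp_all add: nn_integral_eq_integral)
  then have "4 * (\<integral>\<^sup>+ z. ennreal (min 1 ((norm z)\<^sup>2) / norm z powr (real DIM('a) + 2 * s)) \<partial>(lborel :: 'a measure))
      * ((\<integral>\<^sup>+ x. ennreal ((\<psi> j x)\<^sup>2) \<partial>lebesgue) + (\<integral>\<^sup>+ x. ennreal ((norm (grad (\<psi> j) x))\<^sup>2) \<partial>lebesgue)) < top"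
    using levy_kernel_integrable[OF s, where 'a='a] by (simp add: ennreal_mult_less_top)
  then show ?thesis
    by (intro integrableI_nonneg)
      (auto intro: le_less_trans[OF frac_energy_le[OF test_fun_smooth[OF test]]])
qed

text \<open>Finite energy passes to \<open>w\<close> from \<open>\<psi> 0\<close>, since their
  difference has finite energy.\<close>

lemma frac_int: "integrable (lebesgue \<Otimes>\<^sub>M lebesgue) (\<lambda>z. (frac_quot s w z)\<^sup>2)"
proof -
  have "integrable (lebesgue \<Otimes>\<^sub>M lebesgue)
      (\<lambda>z. (frac_quot s (\<psi> 0) z - (frac_quot s (\<psi> 0) z - frac_quot s w z))\<^sup>2)"
    by (intro integrable_square_diff frac_test_int frac_diff_int) measurable
  then show ?thesis by simp
qed

text \<open>In the generalised dominated convergence the quotient of \<open>\<psi> j\<close> is the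
  moving part of the majorant, with limit the quotient of \<open>w\<close>, and that of
  \<open>\<psi> k\<close> is the fixed part \<open>c\<close>.\<close>

lemma frac_inner_limit:
  "(\<lambda>j. \<integral>z. frac_quot s w z * frac_quot s (\<lambda>x. cutoff (\<psi> j x) (\<psi> k x)) z \<partial>(lebesgue \<Otimes>\<^sub>M lebesgue))
    \<longlonglongrightarrow> (\<integral>z. frac_quot s w z * frac_quot s (\<lambda>x. cutoff (w x) (\<psi> k x)) z \<partial>(lebesgue \<Otimes>\<^sub>M lebesgue))"
proof -
  have TS: "AE z in lebesgue \<Otimes>\<^sub>M lebesgue. (\<lambda>j. frac_quot s (\<lambda>x. cutoff (\<psi> j x) (\<psi> k x)) z)
      \<longlonglongrightarrow> frac_quot s (\<lambda>x. cutoff (w x) (\<psi> k x)) z"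
    using w_AE_pair by eventually_elim (auto intro!: frac_quot_tendsto tendsto_cutoff)
  have bound: "AE z in lebesgue \<Otimes>\<^sub>M lebesgue. \<bar>frac_quot s (\<lambda>x. cutoff (f x) (g x)) z\<bar> \<le> \<bar>frac_quot s f z\<bar> + \<bar>frac_quot s g z\<bar>"
    for f g :: "'a \<Rightarrow> real"
    by (intro always_eventually allI abs_frac_quot_cutoff_le)
  show ?thesis
    by (rule tendsto_integral_mult_L2_dominated(3)
        [OF _ _ _ _ _ _ frac_int frac_int frac_test_int frac_diff_int frac_diff_lim bound bound TS]) measurable
qed

text \<open>The roles are exchanged: the quotient of \<open>\<psi> k\<close> now moves, and that of
  \<open>w\<close> is the fixed part of the majorant.\<close>

lemma
  shows frac_outer_int: "integrable (lebesgue \<Otimes>\<^sub>M lebesgue) (\<lambda>z. frac_quot s w z * frac_quot s (\<lambda>x. cutoff (w x) (w x)) z)"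
    and frac_outer_lim: "(\<lambda>k. \<integral>z. frac_quot s w z * frac_quot s (\<lambda>x. cutoff (w x) (\<psi> k x)) z \<partial>(lebesgue \<Otimes>\<^sub>M lebesgue))
      \<longlonglongrightarrow> (\<integral>z. frac_quot s w z * frac_quot s (\<lambda>x. cutoff (w x) (w x)) z \<partial>(lebesgue \<Otimes>\<^sub>M lebesgue))"
proof -
  have T: "AE z in lebesgue \<Otimes>\<^sub>M lebesgue. \<bar>frac_quot s (\<lambda>x. cutoff (w x) (\<psi> k x)) z\<bar> \<le> \<bar>frac_quot s (\<psi> k) z\<bar> + \<bar>frac_quot s w z\<bar>" for k
    using abs_frac_quot_cutoff_le[of s w "\<psi> k"] by (intro always_eventually) (simp add: add.commute)
  have TS: "AE z in lebesgue \<Otimes>\<^sub>M lebesgue. (\<lambda>k. frac_quot s (\<lambda>x. cutoff (w x) (\<psi> k x)) z)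
      \<longlonglongrightarrow> frac_quot s (\<lambda>x. cutoff (w x) (w x)) z"
    using w_AE_pair by eventually_elim (auto intro!: frac_quot_tendsto tendsto_cutoff)
  have S: "AE z in lebesgue \<Otimes>\<^sub>M lebesgue. \<bar>frac_quot s (\<lambda>x. cutoff (w x) (w x)) z\<bar> \<le> \<bar>frac_quot s w z\<bar> + \<bar>frac_quot s w z\<bar>"
    by (intro always_eventually allI abs_frac_quot_cutoff_le)
  note * = tendsto_integral_mult_L2_dominated[OF _ _ _ _ _ _ frac_int frac_int frac_int frac_diff_int frac_diff_lim T S TS]
  show "integrable (lebesgue \<Otimes>\<^sub>M lebesgue) (\<lambda>z. frac_quot s w z * frac_quot s (\<lambda>x. cutoff (w x) (w x)) z)"
    by (rule *(2)) measurable
  show "(\<lambda>k. \<integral>z. frac_quot s w z * frac_quot s (\<lambda>x. cutoff (w x) (\<psi> k x)) z \<partial>(lebesgue \<Otimes>\<^sub>M lebesgue))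
      \<longlonglongrightarrow> (\<integral>z. frac_quot s w z * frac_quot s (\<lambda>x. cutoff (w x) (w x)) z \<partial>(lebesgue \<Otimes>\<^sub>M lebesgue))"
    by (rule *(3)) measurable
qed

text \<open>The convergence lemma is scalar, so the pairing is treated one coordinate at a time. The
  coefficients converge pointwise and the gradients both pointwise and in L^2; only the smooth
  composites are differentiated.\<close>

lemma grad_inner_limit:
  assumes i: "i \<in> Basis"
  shows "integrable lebesgue (\<lambda>x. (W x \<bullet> i) * (grad (\<lambda>x. cutoff (\<psi> j x) (\<psi> k x)) x \<bullet> i))"
    and "(\<lambda>j. \<integral>x. (W x \<bullet> i) * (grad (\<lambda>x. cutoff (\<psi> j x) (\<psi> k x)) x \<bullet> i) \<partial>lebesgue)
    \<longlonglongrightarrow> (\<integral>x. (W x \<bullet> i) * (cutoff_dt (w x) (\<psi> k x) * (W x \<bullet> i) + cutoff_dp (w x) (\<psi> k x) * (grad (\<psi> k) x \<bullet> i)) \<partial>lebesgue)"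
proof -
  have e: "grad (\<lambda>x. cutoff (\<psi> j x) (\<psi> k x)) x \<bullet> i
    = cutoff_dt (\<psi> j x) (\<psi> k x) * (grad (\<psi> j) x \<bullet> i) + cutoff_dp (\<psi> j x) (\<psi> k x) * (grad (\<psi> k) x \<bullet> i)" for x j
    by (simp add: grad_cutoff test_fun_smooth[OF test] inner_add_left)
  have T: "AE x in lebesgue. \<bar>cutoff_dt (\<psi> j x) (\<psi> k x) * (grad (\<psi> j) x \<bullet> i) + cutoff_dp (\<psi> j x) (\<psi> k x) * (grad (\<psi> k) x \<bullet> i)\<bar>
      \<le> \<bar>grad (\<psi> j) x \<bullet> i\<bar> + \<bar>grad (\<psi> k) x \<bullet> i\<bar>" for j
    by (intro always_eventually allI abs_cutoff_combination_le)
  have S: "AE x in lebesgue. \<bar>cutoff_dt (w x) (\<psi> k x) * (W x \<bullet> i) + cutoff_dp (w x) (\<psi> k x) * (grad (\<psi> k) x \<bullet> i)\<bar>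
      \<le> \<bar>W x \<bullet> i\<bar> + \<bar>grad (\<psi> k) x \<bullet> i\<bar>"
    by (intro always_eventually allI abs_cutoff_combination_le)
  have TS: "AE x in lebesgue. (\<lambda>j. cutoff_dt (\<psi> j x) (\<psi> k x) * (grad (\<psi> j) x \<bullet> i) + cutoff_dp (\<psi> j x) (\<psi> k x) * (grad (\<psi> k) x \<bullet> i))
      \<longlonglongrightarrow> cutoff_dt (w x) (\<psi> k x) * (W x \<bullet> i) + cutoff_dp (w x) (\<psi> k x) * (grad (\<psi> k) x \<bullet> i)"
    using w_AE W_AE by eventually_elim (intro tendsto_intros tendsto_cutoff; assumption)
  note * = tendsto_integral_mult_L2_dominated[OF _ _ _ _ _ _ component_int[OF i] component_int[OF i] grad_component_int[OF i] grad_component_diff_int[OF i] grad_component_lim[OF i] T S TS]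
  show "integrable lebesgue (\<lambda>x. (W x \<bullet> i) * (grad (\<lambda>x. cutoff (\<psi> j x) (\<psi> k x)) x \<bullet> i))"
    unfolding e by (rule *(1)) measurable
  show "(\<lambda>j. \<integral>x. (W x \<bullet> i) * (grad (\<lambda>x. cutoff (\<psi> j x) (\<psi> k x)) x \<bullet> i) \<partial>lebesgue)
    \<longlonglongrightarrow> (\<integral>x. (W x \<bullet> i) * (cutoff_dt (w x) (\<psi> k x) * (W x \<bullet> i) + cutoff_dp (w x) (\<psi> k x) * (grad (\<psi> k) x \<bullet> i)) \<partial>lebesgue)"
    unfolding e by (rule *(3)) measurable
qed

text \<open>As \<open>\<psi> k\<close> tends to \<open>w\<close> and its gradient to
  \<open>W\<close>, both partial derivatives multiply the same vector and merge into the derivative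
  of \<eta> at \<open>w\<close>.\<close>

lemma grad_outer_limit:
  assumes i: "i \<in> Basis"
  shows "(\<lambda>k. \<integral>x. (W x \<bullet> i) * (cutoff_dt (w x) (\<psi> k x) * (W x \<bullet> i) + cutoff_dp (w x) (\<psi> k x) * (grad (\<psi> k) x \<bullet> i)) \<partial>lebesgue)
    \<longlonglongrightarrow> (\<integral>x. (W x \<bullet> i) * ((cutoff_dt (w x) (w x) + cutoff_dp (w x) (w x)) * (W x \<bullet> i)) \<partial>lebesgue)"
proof -
  have T: "AE x in lebesgue. \<bar>cutoff_dt (w x) (\<psi> k x) * (W x \<bullet> i) + cutoff_dp (w x) (\<psi> k x) * (grad (\<psi> k) x \<bullet> i)\<bar>
      \<le> \<bar>grad (\<psi> k) x \<bullet> i\<bar> + \<bar>W x \<bullet> i\<bar>" for k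
    using abs_cutoff_combination_le by (intro always_eventually allI) (simp add: add.commute[of "\<bar>grad _ _ \<bullet> _\<bar>"])
  have S: "AE x in lebesgue. \<bar>(cutoff_dt (w x) (w x) + cutoff_dp (w x) (w x)) * (W x \<bullet> i)\<bar> \<le> \<bar>W x \<bullet> i\<bar> + \<bar>W x \<bullet> i\<bar>"
    unfolding distrib_right by (intro always_eventually allI abs_cutoff_combination_le)
  have TS: "AE x in lebesgue. (\<lambda>k. cutoff_dt (w x) (\<psi> k x) * (W x \<bullet> i) + cutoff_dp (w x) (\<psi> k x) * (grad (\<psi> k) x \<bullet> i))
      \<longlonglongrightarrow> (cutoff_dt (w x) (w x) + cutoff_dp (w x) (w x)) * (W x \<bullet> i)"
    unfolding distrib_right
    using w_AE W_AE by eventually_elim (intro tendsto_intros tendsto_cutoff; assumption)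
  show ?thesis
    by (rule tendsto_integral_mult_L2_dominated(3)[OF _ _ _ _ _ _ component_int[OF i] component_int[OF i]
        component_int[OF i] grad_component_diff_int[OF i] grad_component_lim[OF i] T S TS]) measurable
qed

end

section \<open>Locally integrable sources against test functions\<close>

lemma loc_integrable_mult_bounded:
  assumes U: "U \<in> sets lebesgue" and v: "loc_integrable U v"
    and K: "compact K" "K \<subseteq> U" and B: "0 \<le> B"
  shows "integrable (lebesgue_on U) (\<lambda>x. \<bar>v x\<bar> * (B * indicator K x))"
proof -
  have "integrable (lebesgue_on K) v" using v K by (simp add: loc_integrable_def)
  then have "integrable lebesgue (\<lambda>x. indicator K x *\<^sub>R v x)"
    using lmeasurable_compact[OF K(1)] by (subst (asm) integrable_restrict_space) (auto simp: fmeasurable_def)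
  then have "integrable lebesgue (\<lambda>x. B * \<bar>indicator K x *\<^sub>R v x\<bar>)"
    by (intro integrable_mult_right integrable_abs)
  moreover have "B * \<bar>indicator K x *\<^sub>R v x\<bar> = indicator U x *\<^sub>R (\<bar>v x\<bar> * (B * indicator K x))" for x
    using K by (auto simp: indicator_def)
  ultimately have "integrable lebesgue (\<lambda>x. indicator U x *\<^sub>R (\<bar>v x\<bar> * (B * indicator K x)))"
    by (simp only:)
  then show ?thesis
    using U by (subst integrable_restrict_space) auto
qed

lemma loc_integrable_mult_test_fun:
  assumes U: "U \<in> sets lebesgue" and v: "loc_integrable U v" and \<phi>: "test_fun U \<phi>"
  shows "integrable (lebesgue_on U) (\<lambda>x. v x * \<phi> x)"
proof -
  let ?K = "closure {x. \<phi> x \<noteq> 0}"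
  obtain B where B: "\<And>x. \<bar>\<phi> x\<bar> \<le> B" using test_fun_bounded[OF \<phi>] by metis
  have B0: "0 \<le> B" using B[of 0] by linarith
  have [measurable]: "v \<in> borel_measurable (lebesgue_on U)" using v by (simp add: loc_integrable_def)
  have [measurable]: "\<phi> \<in> borel_measurable (lebesgue_on U)"
    using test_fun_lebesgue[OF \<phi>] by (rule measurable_restrict_space1)
  show ?thesis
  proof (rule Bochner_Integration.integrable_bound)
    show "integrable (lebesgue_on U) (\<lambda>x. \<bar>v x\<bar> * (B * indicator ?K x))"
      by (rule loc_integrable_mult_bounded[OF U v test_fun_compact_support[OF \<phi>] test_fun_support[OF \<phi>] B0])
    have "\<bar>\<phi> x\<bar> \<le> B * indicator ?K x" for x
      using B[of x] closure_subset[of "{x. \<phi> x \<noteq> 0}"] by (cases "\<phi> x = 0") (auto simp: B0)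
    then show "AE x in lebesgue_on U. norm (v x * \<phi> x) \<le> norm (\<bar>v x\<bar> * (B * indicator ?K x))"
      using B0 by (intro always_eventually allI) (simp add: abs_mult mult_left_mono)
  qed measurable
qed

lemma loc_integrable_diff:
  assumes "loc_integrable U f" "loc_integrable U g"
  shows "loc_integrable U (\<lambda>x. f x - g x)"
  using assms by (auto simp: loc_integrable_def)

context test_fun_limit
begin

text \<open>The majorant is |F| times a bound for \<open>\<psi> k\<close> on its support; it is free
  of \<open>j\<close> because \<open>abs_cutoff_le\<close> ignores the first argument.\<close>

lemma source_limit:
  assumes U: "U \<in> sets lebesgue" and F: "loc_integrable U F"
  shows "(\<lambda>j. \<integral>x. F x * cutoff (\<psi> j x) (\<psi> k x) \<partial>lebesgue_on U)
    \<longlonglongrightarrow> (\<integral>x. F x * cutoff (w x) (\<psi> k x) \<partial>lebesgue_on U)"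
proof -
  let ?K = "closure {x. \<psi> k x \<noteq> 0}"
  obtain B where B: "\<And>x. \<bar>\<psi> k x\<bar> \<le> B" using test_fun_bounded[OF test] by metis
  have B0: "0 \<le> B" using B[of 0] by linarith
  have [measurable]: "F \<in> borel_measurable (lebesgue_on U)" using F by (simp add: loc_integrable_def)
  have [measurable]: "\<psi> j \<in> borel_measurable (lebesgue_on U)" "w \<in> borel_measurable (lebesgue_on U)" for j
    by (intro measurable_restrict_space1 \<psi>_meas w_meas)+
  have bound: "\<bar>cutoff t (\<psi> k x)\<bar> \<le> B * indicator ?K x" for t x
    using B[of x] abs_cutoff_le[of t "\<psi> k x"] closure_subset[of "{x. \<psi> k x \<noteq> 0}"]
    by (cases "\<psi> k x = 0") (auto simp: cutoff_0 B0)
  show ?thesis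
  proof (rule integral_dominated_convergence)
    show "integrable (lebesgue_on U) (\<lambda>x. \<bar>F x\<bar> * (B * indicator ?K x))"
      by (rule loc_integrable_mult_bounded[OF U F test_fun_compact_support[OF test] test_fun_support[OF test] B0])
    show "AE x in lebesgue_on U. norm (F x * cutoff (\<psi> j x) (\<psi> k x)) \<le> \<bar>F x\<bar> * (B * indicator ?K x)" for j
      using bound by (intro always_eventually allI) (simp add: abs_mult mult_left_mono)
    have "AE x in lebesgue_on U. (\<lambda>j. \<psi> j x) \<longlonglongrightarrow> w x"
      using w_AE U by (subst AE_restrict_space_iff) (auto elim: eventually_mono)
    then show "AE x in lebesgue_on U. (\<lambda>j. F x * cutoff (\<psi> j x) (\<psi> k x)) \<longlonglongrightarrow> F x * cutoff (w x) (\<psi> k x)"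
      by eventually_elim (intro tendsto_intros tendsto_cutoff)
  qed measurable
qed

text \<open>Two successive limits: for fixed \<open>k\<close> the factor \<open>\<psi> k\<close> keeps the supports in a compact set, so
  the merely locally integrable source passes to the limit \<open>j \<rightarrow> \<infinity>\<close> and acquires a sign; no
  integrability of the source is needed for \<open>k \<rightarrow> \<infinity>\<close>.\<close>

lemma weak_comparison:
  assumes U: "U \<in> sets lebesgue" and F: "loc_integrable U F"
    and sign: "AE x in lebesgue_on U. F x * w x \<le> 0"
    and eq: "\<And>\<phi>. test_fun U \<phi> \<Longrightarrow>
      (\<integral>x. W x \<bullet> grad \<phi> x \<partial>lebesgue)
      + (\<integral>z. frac_quot s w z * frac_quot s \<phi> z \<partial>(lebesgue \<Otimes>\<^sub>M lebesgue))
      = (\<integral>x. F x * \<phi> x \<partial>lebesgue_on U)"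
  shows "AE x in lebesgue. AE y in lebesgue. w x = w y"
proof -
  let ?P = "lebesgue \<Otimes>\<^sub>M lebesgue :: ('a \<times> 'a) measure"
  define L where "L k = (\<Sum>i\<in>Basis. \<integral>x. (W x \<bullet> i) * (cutoff_dt (w x) (\<psi> k x) * (W x \<bullet> i)
      + cutoff_dp (w x) (\<psi> k x) * (grad (\<psi> k) x \<bullet> i)) \<partial>lebesgue)
    + (\<integral>z. frac_quot s w z * frac_quot s (\<lambda>x. cutoff (w x) (\<psi> k x)) z \<partial>?P)" for k
  have L: "L k \<le> 0" for k
  proof -
    define \<theta> where "\<theta> j x = cutoff (\<psi> j x) (\<psi> k x)" for j x
    have \<theta>: "test_fun U (\<theta> j)" for j
      unfolding \<theta>_def by (intro test_fun_cutoff test_fun_smooth[OF test] test)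
    have expand: "W x \<bullet> grad (\<theta> j) x = (\<Sum>i\<in>Basis. (W x \<bullet> i) * (grad (\<theta> j) x \<bullet> i))" for j x
      by (rule euclidean_inner)
    have "(\<integral>x. W x \<bullet> grad (\<theta> j) x \<partial>lebesgue) = (\<Sum>i\<in>Basis. \<integral>x. (W x \<bullet> i) * (grad (\<theta> j) x \<bullet> i) \<partial>lebesgue)" for j
      unfolding expand unfolding \<theta>_def
      by (intro Bochner_Integration.integral_sum grad_inner_limit)
    with eq[OF \<theta>] have e: "(\<Sum>i\<in>Basis. \<integral>x. (W x \<bullet> i) * (grad (\<theta> j) x \<bullet> i) \<partial>lebesgue)
      + (\<integral>z. frac_quot s w z * frac_quot s (\<theta> j) z \<partial>?P) = (\<integral>x. F x * \<theta> j x \<partial>lebesgue_on U)" for j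
      by simp
    have "(\<lambda>j. (\<Sum>i\<in>Basis. \<integral>x. (W x \<bullet> i) * (grad (\<theta> j) x \<bullet> i) \<partial>lebesgue)
      + (\<integral>z. frac_quot s w z * frac_quot s (\<theta> j) z \<partial>?P)) \<longlonglongrightarrow> L k"
      unfolding L_def \<theta>_def by (intro tendsto_add tendsto_sum grad_inner_limit frac_inner_limit)
    moreover have "(\<lambda>j. \<integral>x. F x * \<theta> j x \<partial>lebesgue_on U) \<longlonglongrightarrow> (\<integral>x. F x * cutoff (w x) (\<psi> k x) \<partial>lebesgue_on U)"
      unfolding \<theta>_def by (rule source_limit[OF U F])
    ultimately have "L k = (\<integral>x. F x * cutoff (w x) (\<psi> k x) \<partial>lebesgue_on U)"
      unfolding e by (rule LIMSEQ_unique)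
    also have "\<dots> = - (\<integral>x. - (F x * cutoff (w x) (\<psi> k x)) \<partial>lebesgue_on U)" by simp
    also have "\<dots> \<le> 0"
    proof -
      have "AE x in lebesgue_on U. 0 \<le> - (F x * cutoff (w x) (\<psi> k x))"
        using sign by eventually_elim (simp add: cutoff_nonpos_of_mult)
      then have "0 \<le> (\<integral>x. - (F x * cutoff (w x) (\<psi> k x)) \<partial>lebesgue_on U)"
        by (rule integral_nonneg_AE)
      then show ?thesis by linarith
    qed
    finally show ?thesis .
  qed
  \<comment> \<open>Density of the nonlocal form at \<open>w\<close> and \<eta>(w): an increment of
    \<open>w\<close> times the increment of an increasing function of it, hence nonnegative.\<close>
  define N where "N z = frac_quot s w z * frac_quot s (\<lambda>x. cutoff (w x) (w x)) z" for z
  have N: "N z = (w (fst z) - w (snd z)) * (cutoff (w (fst z)) (w (fst z)) - cutoff (w (snd z)) (w (snd z)))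
      / norm (fst z - snd z) powr (real DIM('a) + 2 * s)" for z
    by (simp add: N_def frac_quot_mult)
  have mono_prod: "0 < (a - b) * (cutoff a a - cutoff b b)" if "a \<noteq> b" for a b
    using that cutoff_diagonal_strict_mono[THEN strict_monoD, of a b] cutoff_diagonal_strict_mono[THEN strict_monoD, of b a]
    by (cases "a < b") (auto intro: mult_neg_neg mult_pos_pos)
  have N0: "0 \<le> N z" for z
    unfolding N using mono_prod[of "w (fst z)" "w (snd z)"]
    by (cases "w (fst z) = w (snd z)") auto
  have "L \<longlonglongrightarrow> (\<Sum>i\<in>Basis. \<integral>x. (W x \<bullet> i) * ((cutoff_dt (w x) (w x) + cutoff_dp (w x) (w x)) * (W x \<bullet> i)) \<partial>lebesgue) + (\<integral>z. N z \<partial>?P)"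
    unfolding L_def[abs_def] N_def by (intro tendsto_add tendsto_sum grad_outer_limit frac_outer_lim)
  then have "(\<Sum>i\<in>Basis. \<integral>x. (W x \<bullet> i) * ((cutoff_dt (w x) (w x) + cutoff_dp (w x) (w x)) * (W x \<bullet> i)) \<partial>lebesgue) + (\<integral>z. N z \<partial>?P) \<le> 0"
    by (rule LIMSEQ_le_const2) (use L in auto)
  moreover have "0 \<le> (W x \<bullet> i) * ((cutoff_dt (w x) (w x) + cutoff_dp (w x) (w x)) * (W x \<bullet> i))" for x i
  proof -
    have "(W x \<bullet> i) * ((cutoff_dt (w x) (w x) + cutoff_dp (w x) (w x)) * (W x \<bullet> i))
      = (cutoff_dt (w x) (w x) + cutoff_dp (w x) (w x)) * (W x \<bullet> i)\<^sup>2"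
      by (simp add: power2_eq_square)
    also have "0 \<le> \<dots>" by (intro mult_nonneg_nonneg cutoff_derivative_diagonal_nonneg) simp
    finally show ?thesis .
  qed
  then have "0 \<le> (\<Sum>i\<in>Basis. \<integral>x. (W x \<bullet> i) * ((cutoff_dt (w x) (w x) + cutoff_dp (w x) (w x)) * (W x \<bullet> i)) \<partial>lebesgue)"
    by (intro sum_nonneg Bochner_Integration.integral_nonneg)
  moreover have "0 \<le> (\<integral>z. N z \<partial>?P)" by (intro Bochner_Integration.integral_nonneg N0)
  ultimately have "(\<integral>z. N z \<partial>?P) = 0" by linarith
  moreover have "integrable ?P N" unfolding N_def[abs_def] by (rule frac_outer_int)
  ultimately have "AE z in ?P. N z = 0"
    using N0 by (subst (asm) integral_nonneg_eq_0_iff_AE) auto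
  then have "AE z in ?P. w (fst z) = w (snd z)"
  proof eventually_elim
    case (elim z)
    show ?case
    proof (rule ccontr)
      assume "w (fst z) \<noteq> w (snd z)"
      \<comment> \<open>Different values force different points, so the denominator is positive; at
        coinciding points the quotient is 0 by convention.\<close>
      then have "fst z \<noteq> snd z" "0 < (w (fst z) - w (snd z)) * (cutoff (w (fst z)) (w (fst z)) - cutoff (w (snd z)) (w (snd z)))"
        by (auto intro: mono_prod)
      then have "0 < N z" unfolding N by (intro divide_pos_pos) auto
      then show False using elim by simp
    qed
  qed
  from lebesgue_pair.AE_pair[OF this] show ?thesis by simp
qed

end

text \<open>A nonzero value shared by almost every point would put almost every point in
  \<open>U\<close>, hence in a ball, and the whole space would have finite measure.\<close>

lemma AE_eq_0_of_AE_const: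
  fixes w :: "'a::euclidean_space \<Rightarrow> real"
  assumes "AE x in lebesgue. AE y in lebesgue. w x = w y"
    and "AE x in lebesgue. x \<notin> U \<longrightarrow> w x = 0" and "bounded U"
  shows "AE x in lebesgue. w x = 0"
  using assms(1)
proof eventually_elim
  case (elim x)
  show ?case
  proof (rule ccontr)
    assume "w x \<noteq> 0"
    obtain e where e: "U \<subseteq> ball 0 e" using bounded_subset_ballD[OF \<open>bounded U\<close>] by blast
    have "AE y in lebesgue. y \<in> ball (0::'a) e"
      using elim assms(2) by eventually_elim (use \<open>w x \<noteq> 0\<close> e in auto)
    then have "emeasure lebesgue (UNIV :: 'a set) = emeasure lebesgue (ball (0::'a) e)"
      by (intro emeasure_eq_AE) auto
    also have "\<dots> < \<infinity>" using emeasure_lborel_ball_finite[of "0::'a" e] by simp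
    finally show False by (simp add: emeasure_lborel_UNIV)
  qed
qed

section \<open>Weak gradients, extension by zero and approximation of the difference\<close>

text \<open>Testing the weak derivative in direction \<open>i\<close> with the i-th partial
  derivative of \<open>\<phi>\<close> gives minus the integral of \<open>u\<close> times the
  Laplacian of \<open>\<phi>\<close>, an expression in which \<open>G\<close> no longer
  occurs.\<close>

lemma weak_grad_inner_grad:
  assumes V: "V \<in> sets lebesgue" and G: "weak_grad V u G" and \<phi>: "test_fun V \<phi>"
  shows "integrable (lebesgue_on V) (\<lambda>x. G x \<bullet> grad \<phi> x)"
    and "(\<integral>x. G x \<bullet> grad \<phi> x \<partial>lebesgue_on V) = - (\<Sum>i\<in>Basis.
      \<integral>x. u x * frechet_derivative (\<lambda>x. frechet_derivative \<phi> (at x) i) (at x) i \<partial>lebesgue_on V)"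
proof -
  have e: "G x \<bullet> grad \<phi> x = (\<Sum>i\<in>Basis. (G x \<bullet> i) * frechet_derivative \<phi> (at x) i)" for x
    by (subst euclidean_inner) (simp add: grad_inner_Basis)
  have int: "integrable (lebesgue_on V) (\<lambda>x. (G x \<bullet> i) * frechet_derivative \<phi> (at x) i)" if "i \<in> Basis" for i
    using G that by (intro loc_integrable_mult_test_fun V test_fun_frechet_derivative \<phi>) (auto simp: weak_grad_def)
  then show "integrable (lebesgue_on V) (\<lambda>x. G x \<bullet> grad \<phi> x)" unfolding e by (rule Bochner_Integration.integrable_sum)
  have "(\<integral>x. u x * frechet_derivative (\<lambda>x. frechet_derivative \<phi> (at x) i) (at x) i \<partial>lebesgue_on V)
    = - (\<integral>x. (G x \<bullet> i) * frechet_derivative \<phi> (at x) i \<partial>lebesgue_on V)" if "i \<in> Basis" for i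
    using G that test_fun_frechet_derivative[OF \<phi>, of i] unfolding weak_grad_def by blast
  then show "(\<integral>x. G x \<bullet> grad \<phi> x \<partial>lebesgue_on V) = - (\<Sum>i\<in>Basis.
      \<integral>x. u x * frechet_derivative (\<lambda>x. frechet_derivative \<phi> (at x) i) (at x) i \<partial>lebesgue_on V)"
    unfolding e using int by (simp add: sum_negf)
qed

lemma integral_lebesgue_on_eq:
  fixes f :: "'a::euclidean_space \<Rightarrow> real"
  assumes "U \<in> sets lebesgue" "\<And>x. x \<notin> U \<Longrightarrow> f x = 0"
  shows "(\<integral>x. f x \<partial>lebesgue_on U) = (\<integral>x. f x \<partial>lebesgue)"
proof -
  have "(\<integral>x. f x \<partial>lebesgue_on U) = (\<integral>x. indicator U x *\<^sub>R f x \<partial>lebesgue)"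
    using assms(1) by (simp add: integral_restrict_space)
  also have "(\<lambda>x. indicator U x *\<^sub>R f x) = f"
    using assms(2) by (auto simp: indicator_def fun_eq_iff)
  finally show ?thesis .
qed

text \<open>Integrating by parts once more against the test functions \<open>\<partial>\<^sub>i \<phi>\<close> compares two weak gradients
  without appealing to their uniqueness.\<close>

lemma weak_grad_test_eq:
  assumes U: "U \<in> sets lebesgue" and G: "weak_grad UNIV u G" and H: "weak_grad U u H" and \<phi>: "test_fun U \<phi>"
  shows "(\<integral>x. G x \<bullet> grad \<phi> x \<partial>lebesgue_on U) = (\<integral>x. H x \<bullet> grad \<phi> x \<partial>lebesgue_on U)"
proof -
  have U1: "UNIV \<in> sets (lebesgue :: 'a measure)" by simp
  have \<phi>1: "test_fun UNIV \<phi>" using test_fun_mono[OF \<phi>] by simp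
  have D: "test_fun U (\<lambda>x. frechet_derivative \<phi> (at x) i)" for i
    by (rule test_fun_frechet_derivative[OF \<phi>])
  have z: "grad \<phi> x = 0" if "x \<notin> U" for x
    using test_fun_eq_0[OF D that] by (simp add: grad_def)
  have z2: "frechet_derivative (\<lambda>x. frechet_derivative \<phi> (at x) i) (at x) i = 0" if "x \<notin> U" for x i
    using test_fun_eq_0[OF test_fun_frechet_derivative[OF D] that] .
  have "(\<integral>x. G x \<bullet> grad \<phi> x \<partial>lebesgue_on U) = (\<integral>x. G x \<bullet> grad \<phi> x \<partial>lebesgue)"
    by (rule integral_lebesgue_on_eq[OF U]) (simp add: z)
  also have "\<dots> = - (\<Sum>i\<in>Basis. \<integral>x. u x * frechet_derivative (\<lambda>x. frechet_derivative \<phi> (at x) i) (at x) i \<partial>lebesgue)"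
    using weak_grad_inner_grad(2)[OF U1 G \<phi>1] by (simp only: lebesgue_on_UNIV_eq)
  also have "\<dots> = - (\<Sum>i\<in>Basis. \<integral>x. u x * frechet_derivative (\<lambda>x. frechet_derivative \<phi> (at x) i) (at x) i \<partial>lebesgue_on U)"
    by (simp add: integral_lebesgue_on_eq[OF U] z2)
  also have "\<dots> = (\<integral>x. H x \<bullet> grad \<phi> x \<partial>lebesgue_on U)"
    by (rule weak_grad_inner_grad(2)[OF U H \<phi>, symmetric])
  finally show ?thesis .
qed

lemma abs_powr_2: "\<bar>x\<bar> powr 2 = x\<^sup>2" for x :: real
  by (cases "x = 0") (auto simp: powr_numeral)

lemma norm_powr_2: "norm x powr 2 = (norm x)\<^sup>2"
  using abs_powr_2[of "norm x"] by simp

text \<open>The H_0^1 data live on \<open>U\<close>, while the nonlocal term needs the whole space.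
  Extending \<open>H\<close> by zero preserves all the integrals, because \<open>u\<close> and the
  test functions contribute nothing outside \<open>U\<close>.\<close>

lemma sobolev0_2_approximation:
  fixes u :: "'a::euclidean_space \<Rightarrow> real"
  assumes U: "U \<in> sets lebesgue" and u: "sobolev0 2 U u" and um [measurable]: "u \<in> borel_measurable lebesgue"
    and off: "AE x in lebesgue. x \<notin> U \<longrightarrow> u x = 0"
  obtains H \<phi> where "weak_grad U u H" "\<forall>k. test_fun U (\<phi> k)"
    "(\<lambda>x. indicator U x *\<^sub>R H x) \<in> borel_measurable lebesgue"
    "integrable lebesgue (\<lambda>x. (u x)\<^sup>2)"
    "integrable lebesgue (\<lambda>x. (norm (indicator U x *\<^sub>R H x))\<^sup>2)"
    "(\<lambda>k. (\<integral>x. (\<phi> k x - u x)\<^sup>2 \<partial>lebesgue)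
      + (\<integral>x. (norm (grad (\<phi> k) x - indicator U x *\<^sub>R H x))\<^sup>2 \<partial>lebesgue)) \<longlonglongrightarrow> 0"
proof -
  note [measurable] = U
  obtain H \<phi> where H: "sobolev_grad 2 U u H" and \<phi>: "\<And>k. test_fun U (\<phi> k)"
    and lim: "(\<lambda>k. (\<integral>x. \<bar>\<phi> k x - u x\<bar> powr 2 \<partial>lebesgue_on U)
            + (\<integral>x. norm (grad (\<phi> k) x - H x) powr 2 \<partial>lebesgue_on U)) \<longlonglongrightarrow> 0"
    using u unfolding sobolev0_def by blast
  let ?H = "\<lambda>x. indicator U x *\<^sub>R H x"
  have H': "weak_grad U u H" "H \<in> borel_measurable (lebesgue_on U)"
    "integrable (lebesgue_on U) (\<lambda>x. (u x)\<^sup>2)" "integrable (lebesgue_on U) (\<lambda>x. (norm (H x))\<^sup>2)"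
    using H by (auto simp: sobolev_grad_def abs_powr_2 norm_powr_2)
  have Hm: "?H \<in> borel_measurable lebesgue"
    using H'(2) U by (simp add: borel_measurable_restrict_space_iff)
  have "integrable lebesgue (\<lambda>x. indicator U x *\<^sub>R (u x)\<^sup>2)"
    using H'(3) U by (simp add: integrable_restrict_space)
  moreover have "(\<lambda>x. (u x)\<^sup>2) \<in> borel_measurable lebesgue" by measurable
  \<comment> \<open>\<open>u\<close> vanishes outside \<open>U\<close> only almost everywhere, so
    the integrands agree up to a null set; for the gradients below the agreement holds at every
    point.\<close>
  moreover have "AE x in lebesgue. indicator U x *\<^sub>R (u x)\<^sup>2 = (u x)\<^sup>2"
    using off by eventually_elim (auto simp: indicator_def)
  ultimately have ui: "integrable lebesgue (\<lambda>x. (u x)\<^sup>2)"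
    by (rule integrable_cong_AE_imp)
  have "integrable lebesgue (\<lambda>x. indicator U x *\<^sub>R (norm (H x))\<^sup>2)"
    using H'(4) U by (simp add: integrable_restrict_space)
  moreover have "indicator U x *\<^sub>R (norm (H x))\<^sup>2 = (norm (?H x))\<^sup>2" for x
    by (auto simp: indicator_def)
  ultimately have Hi: "integrable lebesgue (\<lambda>x. (norm (?H x))\<^sup>2)" by (simp only:)
  have 1: "(\<integral>x. \<bar>\<phi> k x - u x\<bar> powr 2 \<partial>lebesgue_on U) = (\<integral>x. (\<phi> k x - u x)\<^sup>2 \<partial>lebesgue)" for k
  proof -
    have [measurable]: "\<phi> k \<in> borel_measurable lebesgue" by (rule test_fun_lebesgue[OF \<phi>])
    have "(\<integral>x. \<bar>\<phi> k x - u x\<bar> powr 2 \<partial>lebesgue_on U) = (\<integral>x. indicator U x *\<^sub>R (\<phi> k x - u x)\<^sup>2 \<partial>lebesgue)"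
      using U by (simp add: integral_restrict_space abs_powr_2)
    also have "\<dots> = (\<integral>x. (\<phi> k x - u x)\<^sup>2 \<partial>lebesgue)"
    proof (rule integral_cong_AE)
      show "AE x in lebesgue. indicator U x *\<^sub>R (\<phi> k x - u x)\<^sup>2 = (\<phi> k x - u x)\<^sup>2"
        using off by eventually_elim (auto simp: indicator_def test_fun_eq_0[OF \<phi>])
    qed measurable
    finally show ?thesis .
  qed
  have 2: "(\<integral>x. norm (grad (\<phi> k) x - H x) powr 2 \<partial>lebesgue_on U) = (\<integral>x. (norm (grad (\<phi> k) x - ?H x))\<^sup>2 \<partial>lebesgue)" for k
  proof -
    have "grad (\<phi> k) x = 0" if "x \<notin> U" for x
      using test_fun_eq_0[OF test_fun_frechet_derivative[OF \<phi>] that] by (simp add: grad_def)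
    then have "indicator U x *\<^sub>R (norm (grad (\<phi> k) x - H x))\<^sup>2 = (norm (grad (\<phi> k) x - ?H x))\<^sup>2" for x
      by (auto simp: indicator_def)
    then show ?thesis
      using U by (simp add: integral_restrict_space norm_powr_2)
  qed
  show ?thesis
    by (rule that[OF H'(1) allI[OF \<phi>] Hm ui Hi lim[unfolded 1 2]])
qed

text \<open>The differences of the two approximating sequences converge in norm; passing to a
  subsequence supplies the almost everywhere convergence that the locale also demands.\<close>

lemma test_fun_limit_diff:
  fixes u1 u2 :: "'a::euclidean_space \<Rightarrow> real"
  assumes s: "0 < s" "s < 1"
    and test: "\<And>k. test_fun U (\<phi>1 k)" "\<And>k. test_fun U (\<phi>2 k)"
    and meas: "u1 \<in> borel_measurable lebesgue" "u2 \<in> borel_measurable lebesgue"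
      "H1 \<in> borel_measurable lebesgue" "H2 \<in> borel_measurable lebesgue"
    and int: "integrable lebesgue (\<lambda>x. (u1 x)\<^sup>2)" "integrable lebesgue (\<lambda>x. (u2 x)\<^sup>2)"
      "integrable lebesgue (\<lambda>x. (norm (H1 x))\<^sup>2)" "integrable lebesgue (\<lambda>x. (norm (H2 x))\<^sup>2)"
    and lim1: "(\<lambda>k. (\<integral>x. (\<phi>1 k x - u1 x)\<^sup>2 \<partial>lebesgue) + (\<integral>x. (norm (grad (\<phi>1 k) x - H1 x))\<^sup>2 \<partial>lebesgue)) \<longlonglongrightarrow> 0"
    and lim2: "(\<lambda>k. (\<integral>x. (\<phi>2 k x - u2 x)\<^sup>2 \<partial>lebesgue) + (\<integral>x. (norm (grad (\<phi>2 k) x - H2 x))\<^sup>2 \<partial>lebesgue)) \<longlonglongrightarrow> 0"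
  obtains \<psi> where "test_fun_limit U s \<psi> (\<lambda>x. u1 x - u2 x) (\<lambda>x. H1 x - H2 x)"
proof -
  note [measurable] = meas test_fun_lebesgue[OF test(1)] test_fun_lebesgue[OF test(2)]
    test_fun_grad_lebesgue[OF test(1)] test_fun_grad_lebesgue[OF test(2)]
  have sq: "norm ((a - b) - (c - d)) ^ 2 \<le> 2 * norm (a - c) ^ 2 + 2 * norm (b - d) ^ 2" for a b c d :: "'c::real_inner"
  proof -
    have "2 * norm (a - c) ^ 2 + 2 * norm (b - d) ^ 2 - norm ((a - b) - (c - d)) ^ 2 = norm ((a - c) + (b - d)) ^ 2"
      by (simp add: power2_norm_eq_inner inner_diff_left inner_diff_right inner_add_left inner_add_right inner_commute)
    then show ?thesis using zero_le_power2[of "norm ((a - c) + (b - d))"] by linarith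
  qed
  have vec_int: "integrable lebesgue (\<lambda>x. (norm (f x - g x))\<^sup>2)"
    if [measurable]: "f \<in> borel_measurable lebesgue" "g \<in> borel_measurable lebesgue"
    and "integrable lebesgue (\<lambda>x. (norm (f x))\<^sup>2)" "integrable lebesgue (\<lambda>x. (norm (g x))\<^sup>2)" for f g :: "'a \<Rightarrow> 'a"
  proof (rule Bochner_Integration.integrable_bound)
    show "integrable lebesgue (\<lambda>x. 2 * (norm (f x))\<^sup>2 + 2 * (norm (g x))\<^sup>2)" using that by simp
    show "AE x in lebesgue. norm ((norm (f x - g x))\<^sup>2) \<le> norm (2 * (norm (f x))\<^sup>2 + 2 * (norm (g x))\<^sup>2)"
      using sq[of "f x" "g x" 0 0 for x] by (intro always_eventually allI) simp
  qed measurable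
  \<comment> \<open>Function and gradient errors share one density, so a single subsequence serves
    both: each error is at most the square root of \<open>E\<close>.\<close>
  define E where "E k x = ((\<phi>1 k x - \<phi>2 k x) - (u1 x - u2 x))\<^sup>2
    + (norm ((grad (\<phi>1 k) x - grad (\<phi>2 k) x) - (H1 x - H2 x)))\<^sup>2" for k x
  have E0: "0 \<le> E k x" for k x by (simp add: E_def)
  have i: "integrable lebesgue (\<lambda>x. (\<phi>1 k x - u1 x)\<^sup>2)" "integrable lebesgue (\<lambda>x. (\<phi>2 k x - u2 x)\<^sup>2)"
    "integrable lebesgue (\<lambda>x. (norm (grad (\<phi>1 k) x - H1 x))\<^sup>2)" "integrable lebesgue (\<lambda>x. (norm (grad (\<phi>2 k) x - H2 x))\<^sup>2)" for k
    by (intro integrable_square_diff vec_int int test_fun_square_integrable[OF test(1)] test_fun_square_integrable[OF test(2)]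
        test_fun_grad_square_integrable[OF test(1)] test_fun_grad_square_integrable[OF test(2)]; measurable)+
  have wi: "integrable lebesgue (\<lambda>x. (u1 x - u2 x)\<^sup>2)" "integrable lebesgue (\<lambda>x. (norm (H1 x - H2 x))\<^sup>2)"
    by (intro integrable_square_diff vec_int int meas)+
  have i1: "integrable lebesgue (\<lambda>x. ((\<phi>1 k x - \<phi>2 k x) - (u1 x - u2 x))\<^sup>2)"
    and i2: "integrable lebesgue (\<lambda>x. (norm ((grad (\<phi>1 k) x - grad (\<phi>2 k) x) - (H1 x - H2 x)))\<^sup>2)" for k
    by (intro integrable_square_diff vec_int wi int test_fun_square_integrable[OF test(1)] test_fun_square_integrable[OF test(2)]
        test_fun_grad_square_integrable[OF test(1)] test_fun_grad_square_integrable[OF test(2)]; measurable)+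
  have Ei: "integrable lebesgue (E k)" for k
    unfolding E_def by (intro Bochner_Integration.integrable_add i1 i2)
  have Ele: "(\<integral>x. E k x \<partial>lebesgue)
    \<le> 2 * ((\<integral>x. (\<phi>1 k x - u1 x)\<^sup>2 \<partial>lebesgue) + (\<integral>x. (norm (grad (\<phi>1 k) x - H1 x))\<^sup>2 \<partial>lebesgue))
      + 2 * ((\<integral>x. (\<phi>2 k x - u2 x)\<^sup>2 \<partial>lebesgue) + (\<integral>x. (norm (grad (\<phi>2 k) x - H2 x))\<^sup>2 \<partial>lebesgue))" (is "_ \<le> ?R k") for k
  proof -
    have "(\<integral>x. E k x \<partial>lebesgue) \<le> (\<integral>x. (2 * (\<phi>1 k x - u1 x)\<^sup>2 + 2 * (\<phi>2 k x - u2 x)\<^sup>2)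
      + (2 * (norm (grad (\<phi>1 k) x - H1 x))\<^sup>2 + 2 * (norm (grad (\<phi>2 k) x - H2 x))\<^sup>2) \<partial>lebesgue)"
    proof (intro integral_mono Ei)
      show "E k x \<le> (2 * (\<phi>1 k x - u1 x)\<^sup>2 + 2 * (\<phi>2 k x - u2 x)\<^sup>2)
        + (2 * (norm (grad (\<phi>1 k) x - H1 x))\<^sup>2 + 2 * (norm (grad (\<phi>2 k) x - H2 x))\<^sup>2)" for x
        unfolding E_def using sq[of "\<phi>1 k x" "\<phi>2 k x" "u1 x" "u2 x"] by (intro add_mono sq) simp
    qed (use i in simp)
    also have "\<dots> = ?R k" using i by simp
    finally show ?thesis .
  qed
  have Elim: "(\<lambda>k. \<integral>x. E k x \<partial>lebesgue) \<longlonglongrightarrow> 0"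
  proof (rule Lim_null_comparison)
    show "\<forall>\<^sub>F k in sequentially. norm (\<integral>x. E k x \<partial>lebesgue) \<le> ?R k"
      using Ele E0 by (intro always_eventually allI) simp
    show "?R \<longlonglongrightarrow> 0"
      using tendsto_add[OF tendsto_mult[OF tendsto_const[of 2] lim1] tendsto_mult[OF tendsto_const[of 2] lim2]] by simp
  qed
  then obtain r where r: "strict_mono r" and rAE: "AE x in lebesgue. (\<lambda>k. E (r k) x) \<longlonglongrightarrow> 0"
    using tendsto_L1_AE_subseq[of lebesgue E] Ei E0 by auto
  define \<psi> where "\<psi> k x = \<phi>1 (r k) x - \<phi>2 (r k) x" for k x
  have g: "grad (\<psi> k) x = grad (\<phi>1 (r k)) x - grad (\<phi>2 (r k)) x" for k x
    unfolding \<psi>_def by (intro grad_diff test_fun_smooth[OF test(1)] test_fun_smooth[OF test(2)])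
  have "(\<lambda>k. \<psi> k x) \<longlonglongrightarrow> u1 x - u2 x \<and> (\<lambda>k. grad (\<psi> k) x) \<longlonglongrightarrow> H1 x - H2 x"
    if lim: "(\<lambda>k. E (r k) x) \<longlonglongrightarrow> 0" for x
  proof -
    have le: "\<bar>\<psi> k x - (u1 x - u2 x)\<bar> \<le> sqrt (E (r k) x)" "norm (grad (\<psi> k) x - (H1 x - H2 x)) \<le> sqrt (E (r k) x)" for k
      by (auto simp: E_def g \<psi>_def intro!: real_le_rsqrt)
    have "(\<lambda>k. sqrt (E (r k) x)) \<longlonglongrightarrow> 0" using tendsto_real_sqrt[OF lim] by simp
    then have "(\<lambda>k. \<psi> k x - (u1 x - u2 x)) \<longlonglongrightarrow> 0" "(\<lambda>k. grad (\<psi> k) x - (H1 x - H2 x)) \<longlonglongrightarrow> 0"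
      by (rule Lim_null_comparison[rotated]; use le in simp)+
    then show ?thesis by (simp add: LIM_zero_iff)
  qed
  with rAE have AE: "AE x in lebesgue. (\<lambda>k. \<psi> k x) \<longlonglongrightarrow> u1 x - u2 x \<and> (\<lambda>k. grad (\<psi> k) x) \<longlonglongrightarrow> H1 x - H2 x"
    by (auto elim: eventually_mono)
  show ?thesis
  proof (rule that[of \<psi>], unfold_locales)
    show "0 < s" "s < 1" by fact+
    show "test_fun U (\<psi> k)" for k unfolding \<psi>_def by (intro test_fun_diff test)
    show "(\<lambda>x. u1 x - u2 x) \<in> borel_measurable lebesgue" "(\<lambda>x. H1 x - H2 x) \<in> borel_measurable lebesgue" by measurable
    show "integrable lebesgue (\<lambda>x. (u1 x - u2 x)\<^sup>2)" "integrable lebesgue (\<lambda>x. (norm (H1 x - H2 x))\<^sup>2)" by fact+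
    show "AE x in lebesgue. (\<lambda>k. \<psi> k x) \<longlonglongrightarrow> u1 x - u2 x" "AE x in lebesgue. (\<lambda>k. grad (\<psi> k) x) \<longlonglongrightarrow> H1 x - H2 x"
      using AE by (auto elim: eventually_mono)
    have "(\<lambda>k. \<integral>x. E (r k) x \<partial>lebesgue) \<longlonglongrightarrow> 0"
      using LIMSEQ_subseq_LIMSEQ[OF Elim r] by (simp add: comp_def)
    then show "(\<lambda>k. (\<integral>x. (\<psi> k x - (u1 x - u2 x))\<^sup>2 \<partial>lebesgue) + (\<integral>x. (norm (grad (\<psi> k) x - (H1 x - H2 x)))\<^sup>2 \<partial>lebesgue)) \<longlonglongrightarrow> 0"
      unfolding E_def using i1 i2 by (simp add: g \<psi>_def)
  qed
qed

text \<open>Only finiteness of \<open>h\<close> on the positive axis makes \<open>real_of_ereal \<circ> h\<close> monotone there, since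
  \<open>real_of_ereal \<infinity> = 0\<close>.\<close>

lemma source_mult_diff_nonpos:
  fixes h :: "real \<Rightarrow> ereal" and g :: "real \<Rightarrow> real"
  assumes h: "\<And>a b. 0 \<le> a \<Longrightarrow> a \<le> b \<Longrightarrow> h b \<le> h a" and fin: "\<And>t. 0 < t \<Longrightarrow> 0 < h t \<and> h t < \<infinity>"
    and g: "\<And>a b. 0 \<le> a \<Longrightarrow> a \<le> b \<Longrightarrow> g a \<le> g b"
    and "0 < a" "0 < b" "0 \<le> c"
  shows "((real_of_ereal (h a) * c - real_of_ereal (h b) * c) - (g a - g b)) * (a - b) \<le> 0"
proof -
  have le: "((real_of_ereal (h a) * c - real_of_ereal (h b) * c) - (g a - g b)) * (a - b) \<le> 0"
    if "0 < a" "a \<le> b" for a b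
  proof -
    have "real_of_ereal (h b) \<le> real_of_ereal (h a)"
      using fin[of a] fin[of b] h[of a b] that by (intro real_of_ereal_positive_mono) auto
    then have "real_of_ereal (h b) * c \<le> real_of_ereal (h a) * c" using \<open>0 \<le> c\<close> by (rule mult_right_mono)
    moreover have "g a \<le> g b" using g that by simp
    ultimately show ?thesis using that by (intro mult_nonneg_nonpos) auto
  qed
  show ?thesis
  proof (cases "a \<le> b")
    case True
    then show ?thesis using le \<open>0 < a\<close> by blast
  next
    case False
    then have "((real_of_ereal (h b) * c - real_of_ereal (h a) * c) - (g b - g a)) * (b - a) \<le> 0"
      using le \<open>0 < b\<close> by simp
    then show ?thesis by (simp add: algebra_simps)
  qed
qed

text \<open>The gradient of a distributional solution is traded for the \<open>L\<^sup>2\<close> one supplied by \<open>H\<^sub>0\<^sup>1\<close>.\<close>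

lemma dist_solution_weak_form:
  fixes u :: "'a::euclidean_space \<Rightarrow> real"
  assumes \<Omega>: "\<Omega> \<in> sets lebesgue" and sol: "dist_solution s \<Omega> h f g u" and H1: "sobolev0 2 \<Omega> u"
  obtains H \<phi> where "weak_grad \<Omega> u H" "\<forall>k. test_fun \<Omega> (\<phi> k)" "u \<in> borel_measurable lebesgue"
    "(\<lambda>x. indicator \<Omega> x *\<^sub>R H x) \<in> borel_measurable lebesgue"
    "integrable lebesgue (\<lambda>x. (u x)\<^sup>2)" "integrable lebesgue (\<lambda>x. (norm (indicator \<Omega> x *\<^sub>R H x))\<^sup>2)"
    "(\<lambda>k. (\<integral>x. (\<phi> k x - u x)\<^sup>2 \<partial>lebesgue)
      + (\<integral>x. (norm (grad (\<phi> k) x - indicator \<Omega> x *\<^sub>R H x))\<^sup>2 \<partial>lebesgue)) \<longlonglongrightarrow> 0"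
    "AE x in lebesgue. x \<notin> \<Omega> \<longrightarrow> u x = 0" "AE x in lebesgue_on \<Omega>. 0 < u x"
    "loc_integrable \<Omega> (\<lambda>x. g (u x))" "loc_integrable \<Omega> (\<lambda>x. real_of_ereal (h (u x)) * f x)"
    "\<forall>\<phi>. test_fun \<Omega> \<phi> \<longrightarrow>
      integrable (lebesgue \<Otimes>\<^sub>M lebesgue) (\<lambda>z. frac_quot s u z * frac_quot s \<phi> z) \<and>
      (\<integral>x. H x \<bullet> grad \<phi> x \<partial>lebesgue_on \<Omega>)
        + (\<integral>z. frac_quot s u z * frac_quot s \<phi> z \<partial>(lebesgue \<Otimes>\<^sub>M lebesgue))
        + (\<integral>x. g (u x) * \<phi> x \<partial>lebesgue_on \<Omega>)
      = (\<integral>x. real_of_ereal (h (u x)) * f x * \<phi> x \<partial>lebesgue_on \<Omega>)"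
proof -
  have split: "(\<lambda>(x, y). (u x - u y) * (\<phi> x - \<phi> y) / norm (x - y) powr (real DIM('a) + 2 * s))
    = (\<lambda>z. frac_quot s u z * frac_quot s \<phi> z)" for \<phi>
    by (simp add: frac_quot_mult case_prod_beta fun_eq_iff)
  obtain G where G: "sobolev_grad 1 UNIV u G"
    and off: "AE x in lebesgue. x \<notin> \<Omega> \<longrightarrow> u x = 0" and pos: "AE x in lebesgue_on \<Omega>. 0 < u x"
    and loc: "loc_integrable \<Omega> (\<lambda>x. g (u x))" "loc_integrable \<Omega> (\<lambda>x. real_of_ereal (h (u x)) * f x)"
    and eq: "\<forall>\<phi>. test_fun \<Omega> \<phi> \<longrightarrow>
      integrable (lebesgue \<Otimes>\<^sub>M lebesgue) (\<lambda>z. frac_quot s u z * frac_quot s \<phi> z) \<and>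
      (\<integral>x. G x \<bullet> grad \<phi> x \<partial>lebesgue_on \<Omega>)
        + (\<integral>z. frac_quot s u z * frac_quot s \<phi> z \<partial>(lebesgue \<Otimes>\<^sub>M lebesgue))
        + (\<integral>x. g (u x) * \<phi> x \<partial>lebesgue_on \<Omega>)
      = (\<integral>x. real_of_ereal (h (u x)) * f x * \<phi> x \<partial>lebesgue_on \<Omega>)"
    using sol unfolding dist_solution_def split by (elim exE conjE) (rule that; assumption)
  have um: "u \<in> borel_measurable lebesgue" and wG: "weak_grad UNIV u G"
    using G by (simp_all add: sobolev_grad_def lebesgue_on_UNIV_eq)
  obtain H \<phi> where H: "weak_grad \<Omega> u H" and approx: "\<forall>k. test_fun \<Omega> (\<phi> k)"
    "(\<lambda>x. indicator \<Omega> x *\<^sub>R H x) \<in> borel_measurable lebesgue" "integrable lebesgue (\<lambda>x. (u x)\<^sup>2)"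
    "integrable lebesgue (\<lambda>x. (norm (indicator \<Omega> x *\<^sub>R H x))\<^sup>2)"
    "(\<lambda>k. (\<integral>x. (\<phi> k x - u x)\<^sup>2 \<partial>lebesgue)
      + (\<integral>x. (norm (grad (\<phi> k) x - indicator \<Omega> x *\<^sub>R H x))\<^sup>2 \<partial>lebesgue)) \<longlonglongrightarrow> 0"
    by (rule sobolev0_2_approximation[OF \<Omega> H1 um off]) (rule that; assumption)
  show ?thesis
  proof (rule that[OF H approx(1) um approx(2-5) off pos loc], intro allI impI)
    fix \<phi> :: "'a \<Rightarrow> real" assume \<phi>: "test_fun \<Omega> \<phi>"
    show "integrable (lebesgue \<Otimes>\<^sub>M lebesgue) (\<lambda>z. frac_quot s u z * frac_quot s \<phi> z) \<and>
      (\<integral>x. H x \<bullet> grad \<phi> x \<partial>lebesgue_on \<Omega>)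
        + (\<integral>z. frac_quot s u z * frac_quot s \<phi> z \<partial>(lebesgue \<Otimes>\<^sub>M lebesgue))
        + (\<integral>x. g (u x) * \<phi> x \<partial>lebesgue_on \<Omega>)
      = (\<integral>x. real_of_ereal (h (u x)) * f x * \<phi> x \<partial>lebesgue_on \<Omega>)"
      using eq[rule_format, OF \<phi>] unfolding weak_grad_test_eq[OF \<Omega> wG H \<phi>] .
  qed
qed

text \<open>Uniqueness is equality almost everywhere, as the functions represent Sobolev classes; it
  is asserted on the whole space, where both solutions have the same exterior data.\<close>

theorem theorem1p3:
  fixes \<Omega> :: "'a::euclidean_space set" and s :: real
    and h :: "real \<Rightarrow> ereal" and f :: "'a \<Rightarrow> real" and g :: "real \<Rightarrow> real"
    and u1 u2 :: "'a \<Rightarrow> real"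
  assumes "open \<Omega>" and "bounded \<Omega>" and "smooth_boundary \<Omega>"
    and "0 < s" and "s < 1"
    and "hyp_hfg s \<Omega> h f g"
    and "\<And>a b. 0 \<le> a \<Longrightarrow> a \<le> b \<Longrightarrow> h b \<le> h a"
    and "\<And>a b. 0 \<le> a \<Longrightarrow> a \<le> b \<Longrightarrow> g a \<le> g b"
    and "dist_solution s \<Omega> h f g u1" and "sobolev0 2 \<Omega> u1"
    and "integrable (lebesgue_on \<Omega>) (\<lambda>x. g (u1 x))"
    and "dist_solution s \<Omega> h f g u2" and "sobolev0 2 \<Omega> u2"
    and "integrable (lebesgue_on \<Omega>) (\<lambda>x. g (u2 x))"
  shows "AE x in lebesgue. u1 x = u2 x"
proof -
  let ?P = "lebesgue \<Otimes>\<^sub>M lebesgue :: ('a \<times> 'a) measure"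
  have \<Omega>: "\<Omega> \<in> sets lebesgue" using \<open>open \<Omega>\<close> by auto
  have hyp: "\<And>t. 0 < t \<Longrightarrow> 0 < h t \<and> h t < \<infinity>" "\<And>x. x \<in> \<Omega> \<Longrightarrow> 0 \<le> f x"
    using \<open>hyp_hfg s \<Omega> h f g\<close> unfolding hyp_hfg_def by auto
  obtain H1 \<phi>1 where grad1: "weak_grad \<Omega> u1 H1" and test1: "\<forall>k. test_fun \<Omega> (\<phi>1 k)"
    and approx1: "u1 \<in> borel_measurable lebesgue" "(\<lambda>x. indicator \<Omega> x *\<^sub>R H1 x) \<in> borel_measurable lebesgue"
      "integrable lebesgue (\<lambda>x. (u1 x)\<^sup>2)" "integrable lebesgue (\<lambda>x. (norm (indicator \<Omega> x *\<^sub>R H1 x))\<^sup>2)"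
      "(\<lambda>k. (\<integral>x. (\<phi>1 k x - u1 x)\<^sup>2 \<partial>lebesgue)
        + (\<integral>x. (norm (grad (\<phi>1 k) x - indicator \<Omega> x *\<^sub>R H1 x))\<^sup>2 \<partial>lebesgue)) \<longlonglongrightarrow> 0"
    and off1: "AE x in lebesgue. x \<notin> \<Omega> \<longrightarrow> u1 x = 0" and pos1: "AE x in lebesgue_on \<Omega>. 0 < u1 x"
    and loc1: "loc_integrable \<Omega> (\<lambda>x. g (u1 x))" "loc_integrable \<Omega> (\<lambda>x. real_of_ereal (h (u1 x)) * f x)"
    and eq1: "\<forall>\<phi>. test_fun \<Omega> \<phi> \<longrightarrow>
      integrable ?P (\<lambda>z. frac_quot s u1 z * frac_quot s \<phi> z) \<and>
      (\<integral>x. H1 x \<bullet> grad \<phi> x \<partial>lebesgue_on \<Omega>)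
        + (\<integral>z. frac_quot s u1 z * frac_quot s \<phi> z \<partial>?P)
        + (\<integral>x. g (u1 x) * \<phi> x \<partial>lebesgue_on \<Omega>)
      = (\<integral>x. real_of_ereal (h (u1 x)) * f x * \<phi> x \<partial>lebesgue_on \<Omega>)"
    by (rule dist_solution_weak_form[OF \<Omega> \<open>dist_solution s \<Omega> h f g u1\<close> \<open>sobolev0 2 \<Omega> u1\<close>])
      (rule that; assumption)
  obtain H2 \<phi>2 where grad2: "weak_grad \<Omega> u2 H2" and test2: "\<forall>k. test_fun \<Omega> (\<phi>2 k)"
    and approx2: "u2 \<in> borel_measurable lebesgue" "(\<lambda>x. indicator \<Omega> x *\<^sub>R H2 x) \<in> borel_measurable lebesgue"
      "integrable lebesgue (\<lambda>x. (u2 x)\<^sup>2)" "integrable lebesgue (\<lambda>x. (norm (indicator \<Omega> x *\<^sub>R H2 x))\<^sup>2)"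
      "(\<lambda>k. (\<integral>x. (\<phi>2 k x - u2 x)\<^sup>2 \<partial>lebesgue)
        + (\<integral>x. (norm (grad (\<phi>2 k) x - indicator \<Omega> x *\<^sub>R H2 x))\<^sup>2 \<partial>lebesgue)) \<longlonglongrightarrow> 0"
    and off2: "AE x in lebesgue. x \<notin> \<Omega> \<longrightarrow> u2 x = 0" and pos2: "AE x in lebesgue_on \<Omega>. 0 < u2 x"
    and loc2: "loc_integrable \<Omega> (\<lambda>x. g (u2 x))" "loc_integrable \<Omega> (\<lambda>x. real_of_ereal (h (u2 x)) * f x)"
    and eq2: "\<forall>\<phi>. test_fun \<Omega> \<phi> \<longrightarrow>
      integrable ?P (\<lambda>z. frac_quot s u2 z * frac_quot s \<phi> z) \<and>
      (\<integral>x. H2 x \<bullet> grad \<phi> x \<partial>lebesgue_on \<Omega>)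
        + (\<integral>z. frac_quot s u2 z * frac_quot s \<phi> z \<partial>?P)
        + (\<integral>x. g (u2 x) * \<phi> x \<partial>lebesgue_on \<Omega>)
      = (\<integral>x. real_of_ereal (h (u2 x)) * f x * \<phi> x \<partial>lebesgue_on \<Omega>)"
    by (rule dist_solution_weak_form[OF \<Omega> \<open>dist_solution s \<Omega> h f g u2\<close> \<open>sobolev0 2 \<Omega> u2\<close>])
      (rule that; assumption)
  define w where "w x = u1 x - u2 x" for x
  \<comment> \<open>Zero extension turns the local form into an integral over the whole space, as
    the comparison lemma requires.\<close>
  define W where "W x = indicator \<Omega> x *\<^sub>R H1 x - indicator \<Omega> x *\<^sub>R H2 x" for x
  define F where "F x = (real_of_ereal (h (u1 x)) * f x - real_of_ereal (h (u2 x)) * f x) - (g (u1 x) - g (u2 x))" for x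
  obtain \<psi> where lim: "test_fun_limit \<Omega> s \<psi> w W"
    using test_fun_limit_diff[OF \<open>0 < s\<close> \<open>s < 1\<close> test1[rule_format] test2[rule_format]
      approx1(1) approx2(1) approx1(2) approx2(2) approx1(3) approx2(3) approx1(4) approx2(4) approx1(5) approx2(5)]
    unfolding w_def W_def by blast
  have F: "loc_integrable \<Omega> F"
    unfolding F_def by (intro loc_integrable_diff loc1 loc2)
  have sign: "AE x in lebesgue_on \<Omega>. F x * w x \<le> 0"
  proof -
    \<comment> \<open>The sign of \<open>f\<close> is known only at points of
      \<open>\<Omega>\<close>, so membership has to be made explicit before the pointwise
      estimate.\<close>
    have "AE x in lebesgue_on \<Omega>. x \<in> \<Omega>"
      using AE_space[of "lebesgue_on \<Omega>"] by (simp add: space_restrict_space)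
    with pos1 pos2 show ?thesis
    proof eventually_elim
      case (elim x)
      then show ?case
        unfolding F_def w_def
        by (intro source_mult_diff_nonpos assms(7) assms(8) hyp)
    qed
  qed
  have eq: "(\<integral>x. W x \<bullet> grad \<phi> x \<partial>lebesgue) + (\<integral>z. frac_quot s w z * frac_quot s \<phi> z \<partial>?P)
      = (\<integral>x. F x * \<phi> x \<partial>lebesgue_on \<Omega>)" if \<phi>: "test_fun \<Omega> \<phi>" for \<phi>
  proof -
    have "(\<integral>x. W x \<bullet> grad \<phi> x \<partial>lebesgue) = (\<integral>x. W x \<bullet> grad \<phi> x \<partial>lebesgue_on \<Omega>)"
      by (rule integral_lebesgue_on_eq[OF \<Omega>, symmetric]) (simp add: W_def)
    also have "\<dots> = (\<integral>x. H1 x \<bullet> grad \<phi> x - H2 x \<bullet> grad \<phi> x \<partial>lebesgue_on \<Omega>)"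
      by (intro Bochner_Integration.integral_cong) (auto simp: W_def inner_diff_left)
    also have "\<dots> = (\<integral>x. H1 x \<bullet> grad \<phi> x \<partial>lebesgue_on \<Omega>) - (\<integral>x. H2 x \<bullet> grad \<phi> x \<partial>lebesgue_on \<Omega>)"
      by (intro Bochner_Integration.integral_diff weak_grad_inner_grad(1)[OF \<Omega> grad1 \<phi>]
          weak_grad_inner_grad(1)[OF \<Omega> grad2 \<phi>])
    finally have a: "(\<integral>x. W x \<bullet> grad \<phi> x \<partial>lebesgue) = \<dots>" .
    have "(\<integral>z. frac_quot s w z * frac_quot s \<phi> z \<partial>?P)
      = (\<integral>z. frac_quot s u1 z * frac_quot s \<phi> z - frac_quot s u2 z * frac_quot s \<phi> z \<partial>?P)"
      unfolding w_def frac_quot_diff by (simp add: left_diff_distrib)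
    \<comment> \<open>The integral may be split because the weak form asserts the integrability of
      each nonlocal pairing, not only the value of its integral.\<close>
    also have "\<dots> = (\<integral>z. frac_quot s u1 z * frac_quot s \<phi> z \<partial>?P) - (\<integral>z. frac_quot s u2 z * frac_quot s \<phi> z \<partial>?P)"
      using eq1[rule_format, OF \<phi>] eq2[rule_format, OF \<phi>] by simp
    finally have b: "(\<integral>z. frac_quot s w z * frac_quot s \<phi> z \<partial>?P) = \<dots>" .
    have "(\<integral>x. F x * \<phi> x \<partial>lebesgue_on \<Omega>)
      = (\<integral>x. (real_of_ereal (h (u1 x)) * f x * \<phi> x - real_of_ereal (h (u2 x)) * f x * \<phi> x) - (g (u1 x) * \<phi> x - g (u2 x) * \<phi> x) \<partial>lebesgue_on \<Omega>)"
      by (simp add: F_def left_diff_distrib)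
    also have "\<dots> = ((\<integral>x. real_of_ereal (h (u1 x)) * f x * \<phi> x \<partial>lebesgue_on \<Omega>) - (\<integral>x. real_of_ereal (h (u2 x)) * f x * \<phi> x \<partial>lebesgue_on \<Omega>))
      - ((\<integral>x. g (u1 x) * \<phi> x \<partial>lebesgue_on \<Omega>) - (\<integral>x. g (u2 x) * \<phi> x \<partial>lebesgue_on \<Omega>))"
      using loc_integrable_mult_test_fun[OF \<Omega> loc1(1) \<phi>] loc_integrable_mult_test_fun[OF \<Omega> loc1(2) \<phi>]
        loc_integrable_mult_test_fun[OF \<Omega> loc2(1) \<phi>] loc_integrable_mult_test_fun[OF \<Omega> loc2(2) \<phi>]
      by simp
    finally show ?thesis using a b eq1[rule_format, OF \<phi>] eq2[rule_format, OF \<phi>] by simp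
  qed
  have "AE x in lebesgue. AE y in lebesgue. w x = w y"
    by (rule test_fun_limit.weak_comparison[OF lim \<Omega> F sign eq])
  moreover have "AE x in lebesgue. x \<notin> \<Omega> \<longrightarrow> w x = 0"
    using off1 off2 by eventually_elim (simp add: w_def)
  ultimately have "AE x in lebesgue. w x = 0"
    using \<open>bounded \<Omega>\<close> by (rule AE_eq_0_of_AE_const)
  then show ?thesis by eventually_elim (simp add: w_def)
qed

end
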